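(* Let $d\ge1$, $r>0$, $0<s<r$, $\theta>0$, $\mu\in\mathbb{R}^d$. Let $X$ be an $\mathbb{R}^d$-valued random variable with distribution $P=f\cdot\lambda_d$ such that $\mathbb{E}|X|^{r+\delta}<+\infty$ for some $\delta>0$, and let $(a_n)_{n\ge1}$ be an $L^r$-optimal greedy quantization sequence of $X$. Assume $$\int_{\{f>0\}}f^{-\frac{s}{r-s}}f_{\theta,\mu}^{\frac{r}{r-s}}\,d\lambda_d<+\infty .$$ Then, for every $n\ge3$, $$e_s\big(a^{(n)}_{\theta,\mu},P\big)\le \widetilde\kappa\;\theta^{1+\frac ds}\left(\int_{\{f>0\}}f^{-\frac{s}{r-s}}f_{\theta,\mu}^{\frac{r}{r-s}}\,d\lambda_d\right)^{\frac{r-s}{sr}}\sigma_{r+\delta}(P)\,(n-2)^{-\frac1d},$$ where $\sigma_{r+\delta}(P)=e_{r+\delta}(a^{(1)},P)=\big(\mathbb{E}|X-a_1|^{r+\delta}\big)^{\frac{1}{r+\delta}}<+\infty$ and $$\widetilde\kappa=2^{1+\frac1d+\frac\delta r}\,V_d^{-\frac1d}\Big(\frac rd\Big)^{\frac{r}{d(d+r)}}\min_{\varepsilon\in(0,\frac13)}\Big[(1+\varepsilon)\varphi_r(\varepsilon)^{-\frac1d}\Big]\left(\int_{\mathbb{R}^d}(1\vee|x|)^{-d(1+\frac\delta r)}dx\right)^{\frac1d}.$$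
   Context: $|\cdot|$ is a fixed norm on $\mathbb{R}^d$, $\lambda_d$ is Lebesgue measure on $\mathbb{R}^d$, $V_d$ is the $\lambda_d$-volume of the unit ball of $|\cdot|$, and $u\vee v=\max(u,v)$. For a finite set $\Gamma\subset\mathbb{R}^d$ and a probability distribution $P$ on $\mathbb{R}^d$ (the law of $X$), the $L^s$-quantization error is $e_s(\Gamma,P)=e_s(\Gamma,X)=\big(\int \min_{x\in\Gamma}|\xi-x|^s\,dP(\xi)\big)^{1/s}$, $s>0$. An $L^r$-optimal greedy quantization sequence of $X$ (with $\mathbb{E}|X|^r<\infty$) is a sequence $(a_n)_{n\ge1}$ in $\mathbb{R}^d$ such that, with $a^{(0)}=\varnothing$ and $a^{(n)}=\{a_1,\dots,a_n\}$, one has $a_{n+1}\in\operatorname{argmin}_{\xi\in\mathbb{R}^d}e_r(a^{(n)}\cup\{\xi\},X)$ for every $n\ge0$; in particular $a_1$ is an $L^r$-median of $P$. For $\theta>0$, $\mu\in\mathbb{R}^d$: $a^{(n)}_{\theta,\mu}=\{\mu+\theta(a_i-\mu):1\le i\le n\}$ and $f_{\theta,\mu}(x)=f(\mu+\theta(x-\mu))$. Finally $\varphi_r(u)=\big(\frac1{3^r}-u^r\big)u^d$ for $u\in(0,\frac13)$.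
   Formalization: The formal theorem additionally assumes that f_{θ,μ} = 0 almost everywhere on {f = 0}; without this the claim fails, e.g. for d = 1, f the indicator of [0,1], μ = θ = 1/2, r = 2, s = 1. *)

theory Defs
  imports "HOL-Probability.Probability"
begin

text \<open>
  The norm on \<open>\<real>\<^sup>d\<close> is an arbitrary one, hence it is a parameter \<open>N\<close> and not the
  (Euclidean) class operation \<^const>\<open>norm\<close>.
\<close>

definition is_norm :: "(real^'n \<Rightarrow> real) \<Rightarrow> bool" where
  "is_norm N \<longleftrightarrow>
     (\<forall>x. N x = 0 \<longleftrightarrow> x = 0) \<and>
     (\<forall>c x. N (c *\<^sub>R x) = \<bar>c\<bar> * N x) \<and>
     (\<forall>x y. N (x + y) \<le> N x + N y)"

definition unit_ball_volume :: "(real^'n \<Rightarrow> real) \<Rightarrow> real" where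
  "unit_ball_volume N = measure lborel {x. N x \<le> 1}"

text \<open>
  Meant for finite nonempty \<open>\<Gamma>\<close> and for \<open>P\<close> with a finite moment of order \<open>s\<close>; the Bochner
  integral of a non-integrable function would be \<open>0\<close>.
\<close>

definition quant_error ::
  "(real^'n \<Rightarrow> real) \<Rightarrow> real \<Rightarrow> (real^'n) set \<Rightarrow> (real^'n) measure \<Rightarrow> real" where
  "quant_error N s \<Gamma> P =
     (\<integral>\<xi>. Min ((\<lambda>x. N (\<xi> - x) powr s) ` \<Gamma>) \<partial>P) powr (1 / s)"

text \<open>
  Sequences are indexed from \<open>1\<close> (the value at \<open>0\<close> is irrelevant); \<open>a ` {1..n}\<close> is
  \<open>a\<^sup>(\<^sup>n\<^sup>)\<close>, which is empty for \<open>n = 0\<close>.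
\<close>

definition greedy_quantization ::
  "(real^'n \<Rightarrow> real) \<Rightarrow> real \<Rightarrow> (real^'n) measure \<Rightarrow> (nat \<Rightarrow> real^'n) \<Rightarrow> bool" where
  "greedy_quantization N r P a \<longleftrightarrow>
     (\<forall>n. is_arg_min (\<lambda>\<xi>. quant_error N r (a ` {1..n} \<union> {\<xi>}) P) (\<lambda>_. True) (a (Suc n)))"

definition dilate :: "real \<Rightarrow> real^'n \<Rightarrow> real^'n \<Rightarrow> real^'n" where
  "dilate \<theta> \<mu> x = \<mu> + \<theta> *\<^sub>R (x - \<mu>)"

definition phi :: "nat \<Rightarrow> real \<Rightarrow> real \<Rightarrow> real" where
  "phi d r u = ((1/3) powr r - u powr r) * u ^ d"

text \<open>The infimum over \<open>(0, 1/3)\<close> is a minimum: see \<open>min_factor_attained\<close> below.\<close>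

definition min_factor :: "nat \<Rightarrow> real \<Rightarrow> real" where
  "min_factor d r = (INF \<epsilon>\<in>{0<..<1/3}. (1 + \<epsilon>) * phi d r \<epsilon> powr (- 1 / real d))"

definition kappa :: "(real^'n \<Rightarrow> real) \<Rightarrow> real \<Rightarrow> real \<Rightarrow> real" where
  "kappa N r \<delta> =
     (let d = real CARD('n) in
        2 powr (1 + 1 / d + \<delta> / r) * unit_ball_volume N powr (- 1 / d) *
        (r / d) powr (r / (d * (d + r))) * min_factor CARD('n) r *
        (\<integral>x. max 1 (N x) powr (- d * (1 + \<delta> / r)) \<partial>lborel) powr (1 / d))"

definition dilation_integrand ::
  "real \<Rightarrow> real \<Rightarrow> real \<Rightarrow> real^'n \<Rightarrow> (real^'n \<Rightarrow> real) \<Rightarrow> real^'n \<Rightarrow> real" where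
  "dilation_integrand r s \<theta> \<mu> f x =
     f x powr (- s / (r - s)) * f (dilate \<theta> \<mu> x) powr (r / (r - s))"

lemma phi_pos:
  assumes "r > 0" "0 < u" "u < 1/3"
  shows "phi d r u > 0"
  using assms by (simp add: phi_def powr_less_mono2)

lemma min_factor_attained:
  assumes d: "d \<ge> 1" and r: "r > 0"
  shows "\<exists>\<epsilon>\<in>{0<..<1/3}. (1 + \<epsilon>) * phi d r \<epsilon> powr (- 1 / real d) = min_factor d r
           \<and> (\<forall>u\<in>{0<..<1/3}. min_factor d r \<le> (1 + u) * phi d r u powr (- 1 / real d))"
proof -
  let ?h = "\<lambda>u. (1 + u) * phi d r u powr (- 1 / real d)"
  let ?g = "\<lambda>u. phi d r u / (1 + u) ^ d"
  have "continuous_on {0..1/3} ?g"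
    unfolding phi_def using r by (intro continuous_intros continuous_on_powr') auto
  then obtain e where e: "e \<in> {0..1/3}" and emax: "\<And>u. u \<in> {0..1/3} \<Longrightarrow> ?g u \<le> ?g e"
    using continuous_attains_sup[of "{0..1/3::real}" ?g] by auto
  have "0 < ?g (1/6)" using phi_pos[OF r, of "1/6" d] by simp
  also have "\<dots> \<le> ?g e" by (rule emax) auto
  finally have ge: "0 < ?g e" .
  have "?g 0 = 0" "?g (1/3) = 0" using d by (auto simp: phi_def)
  with ge have "e \<noteq> 0" "e \<noteq> 1/3" by (metis less_irrefl)+
  with e have ein: "e \<in> {0<..<1/3}" by auto
  have h_eq: "?h u = ?g u powr (- 1 / real d)" if "u \<in> {0<..<1/3}" for u
  proof -
    have p: "phi d r u > 0" using phi_pos[OF r] that by auto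
    have "((1 + u) ^ d) powr (- 1 / real d) = (1 + u) powr (real d * (- 1 / real d))"
      using that by (simp add: powr_realpow[symmetric] powr_powr)
    also have "\<dots> = 1 / (1 + u)" using d that by (simp add: powr_minus_divide)
    finally show ?thesis using p that by (simp add: powr_divide)
  qed
  have hmin: "?h e \<le> ?h u" if u: "u \<in> {0<..<1/3}" for u
  proof -
    have "0 < ?g u" using phi_pos[OF r, of u d] u by auto
    moreover have "?g u \<le> ?g e" using emax u by auto
    ultimately have "?g e powr (- 1 / real d) \<le> ?g u powr (- 1 / real d)"
      by (intro powr_mono2') auto
    then show ?thesis using h_eq[OF u] h_eq[OF ein] by simp
  qed
  have "min_factor d r = ?h e" unfolding min_factor_def
    using ein hmin by (intro cInf_eq_minimum) auto
  with ein hmin show ?thesis by metis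
qed

end

theory Submission
  imports Defs
begin

text \<open>
  Write \<open>D\<^sub>k \<xi>\<close> for the \<open>N\<close>-distance from \<open>\<xi>\<close> to \<open>{a\<^sub>1, \<dots>, a\<^sub>k}\<close>, \<open>d\<close> for the dimension, and let \<open>E\<^sub>k\<close> be the
  integral of \<open>D\<^sub>k powr r\<close> with respect to \<open>P\<close>. The point \<open>a\<^sub>k\<^sub>+\<^sub>1\<close> is at least as good as any \<open>y\<close>, and adding
  \<open>y\<close> lowers the integrand by at least \<open>(1 - b powr r) * D\<^sub>k \<xi> powr r\<close> wherever \<open>N (y - \<xi>) \<le> b * D\<^sub>k \<xi>\<close>.
  Averaging over \<open>y\<close> with the weight \<open>(1 + (N (y - a\<^sub>1) / \<tau>) powr (r + \<delta>)) powr (- d / r)\<close> and applying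
  Hoelder's inequality gives \<open>E\<^sub>k - E\<^sub>k\<^sub>+\<^sub>1 \<ge> C * E\<^sub>k powr (1 + d / r)\<close>, hence \<open>E\<^sub>n powr (1 / r)\<close> is of order
  \<open>n powr (- 1 / d)\<close>. The dilated \<open>L\<^sup>s\<close>-error reduces to the \<open>L\<^sup>r\<close>-error by a change of variables and
  another application of Hoelder's inequality.

  The weight \<open>max 1 (N (y - a\<^sub>1) / \<tau>) powr (- d * (1 + \<delta> / r))\<close>, whose integral enters \<^const>\<open>kappa\<close>, would
  cost a factor \<open>2 powr (1 / r)\<close>, too much if \<open>r + \<delta> < 1\<close>. With the weight above and the optimal scale \<open>\<tau>\<close>
  the constants can be compared for all \<open>r\<close> and \<open>\<delta>\<close>, by an upper bound for a Beta integral.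
\<close>

subsection \<open>Inequalities for real numbers\<close>

text \<open>The right side is the value of the left at its maximiser \<open>v = q / (p + q)\<close>.
  This is weighted AM-GM with weights \<open>q / S\<close> and \<open>p / S\<close> for
  \<open>v / (q / S)\<close> and \<open>(1 - v) / (p / S)\<close>, whose weighted mean is
  \<open>v + (1 - v) = 1\<close>.\<close>

lemma powr_mult_powr_le_max:
  fixes p q v :: real
  assumes p: "0 < p" and q: "0 < q" and v: "0 \<le> v" "v \<le> 1"
  shows "v powr q * (1 - v) powr p \<le> (q / (p + q)) powr q * (p / (p + q)) powr p"
proof (cases "v = 0 \<or> v = 1")
  case False
  define S where "S = p + q"
  have S: "S > 0" using p q by (simp add: S_def)
  let ?a = "v / (q / S)" and ?b = "(1 - v) / (p / S)"
  have ab: "?a > 0" "?b > 0" using False v p q S by auto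
  have "?a powr (q / S) * ?b powr (p / S) \<le> q / S * ?a + p / S * ?b"
  proof (rule Youngs_inequality_0)
    show "q / S + p / S = 1" using S by (simp add: S_def add_divide_distrib[symmetric])
  qed (use p q S ab in auto)
  also have "\<dots> = 1" using p q S by simp
  finally have "(?a powr (q / S) * ?b powr (p / S)) powr S \<le> 1 powr S"
    using S by (intro powr_mono2) auto
  then have "?a powr q * ?b powr p \<le> 1"
    using S ab by (simp add: powr_mult powr_powr)
  then have "?a powr q * ?b powr p * ((q / S) powr q * (p / S) powr p) \<le> 1 * ((q / S) powr q * (p / S) powr p)"
    by (intro mult_right_mono) auto
  moreover have "?a powr q * (q / S) powr q = v powr q" "?b powr p * (p / S) powr p = (1 - v) powr p"
    using p q S by (simp_all only: powr_mult[symmetric]) simp_all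
  ultimately show ?thesis unfolding S_def[symmetric] by (metis mult.assoc mult.left_commute mult_1)
qed (use p q in auto)

text \<open>The integrand of \<open>Beta q (p + 1)\<close> may be unbounded at 0 when
  \<open>q < 1\<close>. The recurrence raises \<open>q\<close> to \<open>q + 1\<close>; the new
  integrand \<open>t powr q * (1 - t) powr p\<close> is bounded by its maximum on an interval of
  length 1.\<close>

lemma Beta_plus1_le:
  fixes p q :: real
  assumes p: "0 < p" and q: "0 < q"
  shows "Beta q (p + 1) \<le> (p + q + 1) / q * ((q / (p + q)) powr q * (p / (p + q)) powr p)"
proof -
  have "q \<notin> \<int>\<^sub>\<le>\<^sub>0" using q by (auto elim!: nonpos_Ints_cases)
  then have "(q + (p + 1)) * Beta (q + 1) (p + 1) = q * Beta q (p + 1)"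
    by (rule Beta_plus1_left)
  then have eq: "Beta q (p + 1) = (p + q + 1) / q * Beta (q + 1) (p + 1)"
    using q by (simp add: field_simps)
  have "((\<lambda>t. t powr q * (1 - t) powr p) has_integral Beta (q + 1) (p + 1)) {0..1}"
    using has_integral_Beta_real[of "q + 1" "p + 1"] p q by simp
  moreover have "((\<lambda>t. (q / (p + q)) powr q * (p / (p + q)) powr p) has_integral
      (q / (p + q)) powr q * (p / (p + q)) powr p) {0..1::real}"
    using has_integral_const_real[of "(q / (p + q)) powr q * (p / (p + q)) powr p" 0 1] by simp
  ultimately have "Beta (q + 1) (p + 1) \<le> (q / (p + q)) powr q * (p / (p + q)) powr p"
    by (rule has_integral_le) (use p q powr_mult_powr_le_max in auto)
  then show ?thesis unfolding eq using p q by (intro mult_left_mono) auto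
qed

text \<open>Young's inequality for \<open>1 + \<rho>\<close> and
  \<open>(1 + \<rho>) / \<rho>\<close>, whose mean with weights \<open>1 / (1 + \<rho>)\<close> and
  \<open>\<rho> / (1 + \<rho>)\<close> is 2. With \<open>\<rho> = r / d\<close> it produces the
  power of \<open>r / d\<close> in \<open>kappa\<close>.\<close>

lemma one_plus_mult_powr_le_2:
  fixes \<rho> :: real
  assumes \<rho>: "0 < \<rho>"
  shows "1 + \<rho> \<le> 2 * \<rho> powr (\<rho> / (1 + \<rho>))"
proof -
  have "(1 + \<rho>) powr (1 / (1 + \<rho>)) * ((1 + \<rho>) / \<rho>) powr (\<rho> / (1 + \<rho>))
      \<le> 1 / (1 + \<rho>) * (1 + \<rho>) + \<rho> / (1 + \<rho>) * ((1 + \<rho>) / \<rho>)"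
  proof (rule Youngs_inequality_0)
    show "1 / (1 + \<rho>) + \<rho> / (1 + \<rho>) = 1" using \<rho> by (simp add: add_divide_distrib[symmetric])
  qed (use \<rho> in auto)
  also have "\<dots> = 2"
  proof -
    have "1 + \<rho> \<noteq> 0" using \<rho> by simp
    then show ?thesis using \<rho> by simp
  qed
  also have "((1 + \<rho>) / \<rho>) powr (\<rho> / (1 + \<rho>)) = (1 + \<rho>) powr (\<rho> / (1 + \<rho>)) / \<rho> powr (\<rho> / (1 + \<rho>))"
    by (rule powr_divide)
  also have "(1 + \<rho>) powr (1 / (1 + \<rho>)) * ((1 + \<rho>) powr (\<rho> / (1 + \<rho>)) / \<rho> powr (\<rho> / (1 + \<rho>)))
      = (1 + \<rho>) powr (1 / (1 + \<rho>) + \<rho> / (1 + \<rho>)) / \<rho> powr (\<rho> / (1 + \<rho>))"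
    by (simp add: powr_add)
  also have "1 / (1 + \<rho>) + \<rho> / (1 + \<rho>) = 1"
    using \<rho> by (simp add: add_divide_distrib[symmetric])
  finally show ?thesis using \<rho> by (simp add: field_simps)
qed

text \<open>A discrete form of the differential inequality x' \<le> - C x^(1 + \<rho>): as long as
  \<open>x k\<close> is positive, \<open>x k powr (- \<rho>)\<close> grows by at least
  \<open>\<rho> * C\<close> per step. The multiplied form also covers \<open>x n = 0\<close>, and at
  \<open>n = 1\<close> the left side is 0.\<close>

lemma recursive_decrease_bound:
  fixes x :: "nat \<Rightarrow> real" and C \<rho> :: real
  assumes C: "0 < C" and \<rho>: "0 < \<rho>" and nn: "\<And>k. 0 \<le> x k"
    and step: "\<And>k. 1 \<le> k \<Longrightarrow> x (Suc k) + C * x k powr (1 + \<rho>) \<le> x k"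
    and n: "1 \<le> n"
  shows "\<rho> * C * (real n - 1) * x n powr \<rho> \<le> 1"
  using n
proof (induction n rule: dec_induct)
  case (step k)
  show ?case
  proof (cases "x (Suc k) = 0")
    case False
    \<comment> \<open>A lower bound for the relative decrease in one step:
      \<open>x (Suc k) \<le> x k * (1 - u)\<close>.\<close>
    define u where "u = C * x k powr \<rho>"
    have pos: "0 < x (Suc k)" using False nn[of "Suc k"] by simp
    have "x (Suc k) + C * x k powr (1 + \<rho>) \<le> x k" using assms(4) step by auto
    moreover have xk: "0 < x k" 
      using pos calculation C by (smt (verit) mult_nonneg_nonneg powr_ge_zero)
    ultimately have le: "x (Suc k) \<le> x k * (1 - u)"
      using xk by (simp add: u_def powr_add algebra_simps)
    then have "0 < x k * (1 - u)" using pos by linarith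
    then have u: "0 < u" "u < 1" using xk C by (auto simp: u_def zero_less_mult_iff)
    \<comment> \<open>Bernoulli's inequality for a negative exponent, from ln(1 - u) \<le> - u and
      exp t \<ge> 1 + t.\<close>
    have e: "1 + \<rho> * u \<le> (1 - u) powr (- \<rho>)"
    proof -
      have "ln (1 - u) \<le> - u" using ln_add_one_self_le_self2[of "- u"] u by simp
      then have "\<rho> * u \<le> - \<rho> * ln (1 - u)" using mult_left_mono[of "ln (1 - u)" "- u" \<rho>] \<rho> by simp
      then have "1 + \<rho> * u \<le> exp (- \<rho> * ln (1 - u))"
        using exp_ge_add_one_self[of "- \<rho> * ln (1 - u)"] by linarith
      then show ?thesis using u by (simp add: powr_def)
    qed
    have "\<rho> * C * (real (Suc k) - 1) = \<rho> * C * (real k - 1) + \<rho> * C" by (simp add: algebra_simps)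
    also have "\<dots> \<le> x k powr (- \<rho>) + \<rho> * C"
      using step.IH xk by (simp add: powr_minus field_simps)
    also have "\<dots> = x k powr (- \<rho>) * (1 + \<rho> * u)"
      using xk by (simp add: u_def powr_minus field_simps)
    also have "\<dots> \<le> x k powr (- \<rho>) * (1 - u) powr (- \<rho>)" using e by (intro mult_left_mono) auto
    also have "\<dots> = (x k * (1 - u)) powr (- \<rho>)" using xk u by (simp add: powr_mult)
    also have "\<dots> \<le> x (Suc k) powr (- \<rho>)" using le pos \<rho> by (intro powr_mono2') auto
    finally show ?thesis using pos by (simp add: powr_minus field_simps)
  qed simp
qed simp

text \<open>Hoelder's inequality with exponents \<open>1 / \<alpha>\<close> and
  \<open>1 / (1 - \<alpha>)\<close>, the powers being moved inside the integral. Young's inequality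
  gives integrability directly, and the estimate after dividing \<open>f\<close> and
  \<open>g\<close> by their integrals.\<close>

lemma Holder_powr:
  fixes f g :: "'a \<Rightarrow> real"
  assumes \<alpha>: "0 < \<alpha>" "\<alpha> < 1" and f: "integrable M f" and g: "integrable M g"
    and f0: "\<And>x. 0 \<le> f x" and g0: "\<And>x. 0 \<le> g x"
  shows "integrable M (\<lambda>x. f x powr \<alpha> * g x powr (1 - \<alpha>))"
    and "(\<integral>x. f x powr \<alpha> * g x powr (1 - \<alpha>) \<partial>M)
      \<le> (\<integral>x. f x \<partial>M) powr \<alpha> * (\<integral>x. g x \<partial>M) powr (1 - \<alpha>)"
proof -
  have young: "a powr \<alpha> * b powr (1 - \<alpha>) \<le> \<alpha> * a + (1 - \<alpha>) * b" if "0 \<le> a" "0 \<le> b" for a b :: real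
    using Youngs_inequality_0[of \<alpha> "1 - \<alpha>" a b] that \<alpha> by (cases "a = 0 \<or> b = 0") auto
  show int: "integrable M (\<lambda>x. f x powr \<alpha> * g x powr (1 - \<alpha>))"
  proof (rule Bochner_Integration.integrable_bound)
    show "integrable M (\<lambda>x. \<alpha> * f x + (1 - \<alpha>) * g x)" using f g by simp
    show "(\<lambda>x. f x powr \<alpha> * g x powr (1 - \<alpha>)) \<in> borel_measurable M" using f g by measurable
    show "AE x in M. norm (f x powr \<alpha> * g x powr (1 - \<alpha>)) \<le> norm (\<alpha> * f x + (1 - \<alpha>) * g x)"
      using young[OF f0 g0] \<alpha> f0 g0 by (auto simp: abs_mult)
  qed
  define F G where "F = (\<integral>x. f x \<partial>M)" and "G = (\<integral>x. g x \<partial>M)"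
  have FG: "0 \<le> F" "0 \<le> G" using f0 g0 by (auto simp: F_def G_def)
  show "(\<integral>x. f x powr \<alpha> * g x powr (1 - \<alpha>) \<partial>M) \<le> F powr \<alpha> * G powr (1 - \<alpha>)"
  proof (cases "F = 0 \<or> G = 0")
    case True
    then have "(AE x in M. f x = 0) \<or> (AE x in M. g x = 0)"
      using integral_nonneg_eq_0_iff_AE[OF f] integral_nonneg_eq_0_iff_AE[OF g] f0 g0
      by (auto simp: F_def G_def)
    then have "AE x in M. f x powr \<alpha> * g x powr (1 - \<alpha>) = 0" by auto
    then have "(\<integral>x. f x powr \<alpha> * g x powr (1 - \<alpha>) \<partial>M) = 0"
      by (rule integral_eq_zero_AE)
    then show ?thesis by simp
  next
    case False
    then have pos: "0 < F" "0 < G" using FG by auto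
    \<comment> \<open>The last factor integrates to \<open>\<alpha> + (1 - \<alpha>) = 1\<close>, so
      the constant in front is the bound.\<close>
    have pw: "f x powr \<alpha> * g x powr (1 - \<alpha>)
        \<le> F powr \<alpha> * G powr (1 - \<alpha>) * (\<alpha> * (f x / F) + (1 - \<alpha>) * (g x / G))" for x
    proof -
      have "f x powr \<alpha> * g x powr (1 - \<alpha>)
          = F powr \<alpha> * G powr (1 - \<alpha>) * ((f x / F) powr \<alpha> * (g x / G) powr (1 - \<alpha>))"
        using pos f0 g0 by (simp add: powr_divide)
      also have "\<dots> \<le> F powr \<alpha> * G powr (1 - \<alpha>) * (\<alpha> * (f x / F) + (1 - \<alpha>) * (g x / G))"
        using pos f0 g0 by (intro mult_left_mono young) auto
      finally show ?thesis .
    qed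
    have "(\<integral>x. f x powr \<alpha> * g x powr (1 - \<alpha>) \<partial>M)
        \<le> (\<integral>x. F powr \<alpha> * G powr (1 - \<alpha>) * (\<alpha> * (f x / F) + (1 - \<alpha>) * (g x / G)) \<partial>M)"
      using f g by (intro integral_mono int pw) simp
    also have "\<dots> = F powr \<alpha> * G powr (1 - \<alpha>) * (\<alpha> * (F / F) + (1 - \<alpha>) * (G / G))"
      using f g by (simp add: F_def G_def)
    finally show ?thesis using pos by simp
  qed
qed

subsection \<open>Integrals of functions of a norm\<close>

lemma nn_integral_lborel_affine:
  fixes c :: real and t :: "'a::euclidean_space"
  assumes c: "c \<noteq> 0" and g: "g \<in> borel_measurable borel"
  shows "(\<integral>\<^sup>+x. g x \<partial>lborel) = ennreal (\<bar>c\<bar> ^ DIM('a)) * (\<integral>\<^sup>+x. g (t + c *\<^sub>R x) \<partial>lborel)"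
proof -
  have "(\<integral>\<^sup>+x. g x \<partial>lborel)
      = (\<integral>\<^sup>+x. g x \<partial>density (distr lborel borel (\<lambda>x. t + c *\<^sub>R x)) (\<lambda>_. ennreal (\<bar>c\<bar> ^ DIM('a))))"
    using lborel_affine[OF c, of t] by simp
  also have "\<dots> = ennreal (\<bar>c\<bar> ^ DIM('a)) * (\<integral>\<^sup>+x. g (t + c *\<^sub>R x) \<partial>lborel)"
    using g by (simp add: nn_integral_density nn_integral_distr nn_integral_cmult)
  finally show ?thesis .
qed

lemma integral_lborel_affine:
  fixes c :: real and t :: "'a::euclidean_space" and g :: "'a \<Rightarrow> real"
  assumes c: "c \<noteq> 0" and g: "g \<in> borel_measurable borel"
  shows "(\<integral>x. g x \<partial>lborel) = \<bar>c\<bar> ^ DIM('a) * (\<integral>x. g (t + c *\<^sub>R x) \<partial>lborel)"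
proof -
  have "(\<integral>x. g x \<partial>lborel)
      = (\<integral>x. g x \<partial>density (distr lborel borel (\<lambda>x. t + c *\<^sub>R x)) (\<lambda>_. ennreal (\<bar>c\<bar> ^ DIM('a))))"
    using lborel_affine[OF c, of t] by simp
  also have "\<dots> = \<bar>c\<bar> ^ DIM('a) * (\<integral>x. g (t + c *\<^sub>R x) \<partial>lborel)"
    using g by (simp add: integral_density integral_distr)
  finally show ?thesis .
qed

text \<open>Writes a power as an integral over levels, for the layer-cake formula in
  \<open>nn_integral_radial_powr\<close>.\<close>

lemma nn_integral_powr_minus_1:
  fixes S k :: real
  assumes S: "0 < S" and k: "0 \<le> k"
  shows "(\<integral>\<^sup>+v. ennreal (S * v powr (S - 1)) * indicator {0..k} v \<partial>lborel) = ennreal (k powr S)"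
proof (rule nn_integral_has_integral_lebesgue')
  show "((\<lambda>v. S * v powr (S - 1)) has_integral k powr S) {0..k}"
    using has_integral_mult_right[OF has_integral_powr_from_0[of "S - 1" k], of S] S k by simp
qed (use S in auto)

section \<open>Elementary properties of the norm, volume of its balls, and radial integrals\<close>

context
  fixes N :: "real^'n \<Rightarrow> real"
  assumes norm: "is_norm N"
begin

lemma is_norm_zero_iff: "N x = 0 \<longleftrightarrow> x = 0"
  and is_norm_scale: "N (c *\<^sub>R x) = \<bar>c\<bar> * N x"
  and is_norm_triangle: "N (x + y) \<le> N x + N y"
  using norm by (auto simp: is_norm_def)

lemma is_norm_minus: "N (- x) = N x"
  using is_norm_scale[of "-1" x] by simp

lemma is_norm_nonneg: "0 \<le> N x"
  using is_norm_triangle[of x "- x"] is_norm_zero_iff[of 0] by (simp add: is_norm_minus)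

lemma is_norm_diff_commute: "N (x - y) = N (y - x)"
  using is_norm_minus[of "x - y"] by simp

lemma is_norm_triangle_diff: "N (x - z) \<le> N (x - y) + N (y - z)"
  using is_norm_triangle[of "x - y" "y - z"] by simp

text \<open>A finite convex function on a finite-dimensional space is continuous; this also yields
  measurability of \<open>N\<close>.\<close>

lemma is_norm_continuous_on: "continuous_on UNIV N"
proof (rule convex_on_continuous)
  show "convex_on UNIV N"
  proof (rule convex_onI)
    fix t x y assume t: "0 < t" "t < (1::real)"
    show "N ((1 - t) *\<^sub>R x + t *\<^sub>R y) \<le> (1 - t) * N x + t * N y"
      using is_norm_triangle[of "(1 - t) *\<^sub>R x" "t *\<^sub>R y"] t by (simp add: is_norm_scale)
  qed simp
qed simp

lemma is_norm_borel_measurable: "N \<in> borel_measurable borel"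
  by (rule borel_measurable_continuous_onI[OF is_norm_continuous_on])

text \<open>On the compact Euclidean unit sphere \<open>N\<close> attains a positive minimum, so by
  homogeneity it dominates a multiple of the Euclidean norm.\<close>

lemma bounded_unit_ball: "bounded {x. N x \<le> 1}"
proof -
  have "continuous_on (sphere 0 1) N" using is_norm_continuous_on continuous_on_subset by blast
  moreover have "sphere (0::real^'n) 1 \<noteq> {}" by simp
  ultimately obtain z where z: "z \<in> sphere 0 1" and le: "\<And>x. x \<in> sphere 0 1 \<Longrightarrow> N z \<le> N x"
    using continuous_attains_inf[OF compact_sphere] by metis
  have zpos: "0 < N z" using z is_norm_zero_iff[of z] is_norm_nonneg[of z] by (cases "z = 0") auto
  have "norm x \<le> 1 / N z" if "N x \<le> 1" for x
  proof (cases "x = 0")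
    case False
    have "N z \<le> N ((1 / norm x) *\<^sub>R x)" using False by (intro le) simp
    also have "\<dots> = N x / norm x" by (simp add: is_norm_scale)
    finally show ?thesis using that zpos False by (simp add: field_simps)
  qed (use zpos in auto)
  then show ?thesis by (auto simp: bounded_iff)
qed

lemma emeasure_unit_ball: "emeasure lborel {x. N x \<le> 1} = ennreal (unit_ball_volume N)"
  using emeasure_bounded_finite[OF bounded_unit_ball]
  by (simp add: unit_ball_volume_def emeasure_eq_ennreal_measure)

lemma unit_ball_volume_pos: "0 < unit_ball_volume N"
proof -
  have "open {x. N x < 1}" by (rule open_Collect_less[OF is_norm_continuous_on]) simp
  moreover have "0 \<in> {x. N x < 1}" using is_norm_zero_iff[of 0] by simp
  ultimately obtain e where e: "0 < e" "ball 0 e \<subseteq> {x. N x < 1}" 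
    using open_contains_ball by metis
  have sets: "{x. N x \<le> 1} \<in> sets lborel" using is_norm_borel_measurable by measurable
  have "0 < measure lborel (ball (0::real^'n) e)" 
    using content_ball_pos[OF e(1), of "0::real^'n"] by simp
  also have "\<dots> \<le> measure lborel {x. N x \<le> 1}"
  proof (rule measure_mono_fmeasurable)
    show "{x. N x \<le> 1} \<in> fmeasurable lborel"
      using sets emeasure_unit_ball by (intro fmeasurableI) auto
  qed (use e in auto)
  finally show ?thesis by (simp add: unit_ball_volume_def)
qed

lemma emeasure_is_norm_ball:
  assumes t: "0 \<le> t"
  shows "emeasure lborel {y. N (y - x) \<le> t} = ennreal (unit_ball_volume N * t ^ CARD('n))"
proof (cases "t = 0")
  \<comment> \<open>The substitution \<open>x + t *\<^sub>R y\<close> needs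
    \<open>t \<noteq> 0\<close>; for \<open>t = 0\<close> the ball is a single point, a null
    set.\<close>
  case True
  then have "{y. N (y - x) \<le> t} = {x}"
    using is_norm_nonneg is_norm_zero_iff by (force simp: order_antisym_conv)
  then show ?thesis using True by (simp add: power_0_left)
next
  case False
  with t have t: "0 < t" by simp
  have [measurable]: "N \<in> borel_measurable borel" by (rule is_norm_borel_measurable)
  have "emeasure lborel {y. N (y - x) \<le> t} = (\<integral>\<^sup>+y. indicator {y. N (y - x) \<le> t} y \<partial>lborel)"
    by (rule nn_integral_indicator[symmetric]) measurable
  also have "\<dots> = ennreal (\<bar>t\<bar> ^ DIM(real^'n)) * (\<integral>\<^sup>+y. indicator {y. N (y - x) \<le> t} (x + t *\<^sub>R y) \<partial>lborel)"
    by (rule nn_integral_lborel_affine) (use t in simp, measurable)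
  also have "(\<lambda>y. indicator {y. N (y - x) \<le> t} (x + t *\<^sub>R y)) = (indicator {y. N y \<le> 1} :: _ \<Rightarrow> ennreal)"
    using t by (auto simp: is_norm_scale indicator_def fun_eq_iff)
  also have "(\<integral>\<^sup>+y. indicator {y. N y \<le> 1} y \<partial>lborel) = emeasure lborel {y. N y \<le> 1}"
    by (rule nn_integral_indicator) measurable
  finally show ?thesis
    using t emeasure_unit_ball unit_ball_volume_pos
    by (simp add: ennreal_mult mult.commute less_imp_le)
qed

text \<open>Layer-cake formula: write \<open>k x powr S\<close> as an integral over levels
  \<open>v\<close> and exchange the integrals. By \<open>iff\<close> the superlevel set at level
  \<open>v\<close> is the \<open>N\<close>-ball of radius \<open>\<rho> v\<close>, whose volume is
  known.\<close>

lemma nn_integral_radial_powr: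
  fixes k :: "real^'n \<Rightarrow> real" and \<rho> :: "real \<Rightarrow> real"
  assumes k: "k \<in> borel_measurable borel" "\<And>x. 0 < k x" "\<And>x. k x \<le> 1" and S: "0 < S"
    and \<rho>: "\<And>v. 0 < v \<Longrightarrow> v \<le> 1 \<Longrightarrow> 0 \<le> \<rho> v"
    and iff: "\<And>v x. 0 < v \<Longrightarrow> v \<le> 1 \<Longrightarrow> v \<le> k x \<longleftrightarrow> N x \<le> \<rho> v"
  shows "(\<integral>\<^sup>+x. ennreal (k x powr S) \<partial>lborel)
    = (\<integral>\<^sup>+v. ennreal (S * v powr (S - 1) * (unit_ball_volume N * \<rho> v ^ CARD('n))) * indicator {0..1} v \<partial>lborel)"
proof -
  have [measurable]: "k \<in> borel_measurable borel" "N \<in> borel_measurable borel"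
    by (rule k, rule is_norm_borel_measurable)
  have "(\<integral>\<^sup>+x. ennreal (k x powr S) \<partial>lborel)
      = (\<integral>\<^sup>+x. (\<integral>\<^sup>+v. ennreal (S * v powr (S - 1)) * indicator {0..k x} v \<partial>lborel) \<partial>lborel)"
    by (subst nn_integral_powr_minus_1) (use S k in \<open>auto intro: less_imp_le\<close>)
  also have "\<dots> = (\<integral>\<^sup>+v. (\<integral>\<^sup>+x. ennreal (S * v powr (S - 1)) * indicator {0..k x} v \<partial>lborel) \<partial>lborel)"
    unfolding indicator_def atLeastAtMost_iff by (rule lborel_pair.Fubini') measurable
  also have "\<dots> = (\<integral>\<^sup>+v. ennreal (S * v powr (S - 1) * (unit_ball_volume N * \<rho> v ^ CARD('n))) * indicator {0..1} v \<partial>lborel)"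
  proof (rule nn_integral_cong)
    fix v :: real
    \<comment> \<open>Only levels in (0, 1] contribute: at \<open>v = 0\<close> both sides vanish
      since \<open>0 powr (S - 1) = 0\<close>, and above 1 the superlevel set is empty.\<close>
    consider "v \<le> 0" | "1 < v" | "0 < v" "v \<le> 1" by linarith
    then show "(\<integral>\<^sup>+x. ennreal (S * v powr (S - 1)) * indicator {0..k x} v \<partial>lborel)
      = ennreal (S * v powr (S - 1) * (unit_ball_volume N * \<rho> v ^ CARD('n))) * indicator {0..1} v"
    proof cases
      case 2
      then have "v \<notin> {0..k x}" for x using k(3)[of x] by auto
      then show ?thesis using 2 by simp
    next
      case 3
      have "(\<integral>\<^sup>+x. ennreal (S * v powr (S - 1)) * indicator {0..k x} v \<partial>lborel)
          = (\<integral>\<^sup>+x. ennreal (S * v powr (S - 1)) * indicator {x. N (x - 0) \<le> \<rho> v} x \<partial>lborel)"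
        using 3 iff[of v] by (intro nn_integral_cong) (auto simp: indicator_def)
      also have "\<dots> = ennreal (S * v powr (S - 1)) * emeasure lborel {x. N (x - 0) \<le> \<rho> v}"
        by (intro nn_integral_cmult_indicator) measurable
      also have "\<dots> = ennreal (S * v powr (S - 1) * (unit_ball_volume N * \<rho> v ^ CARD('n)))"
        using \<rho>[of v] 3 S by (subst emeasure_is_norm_ball) (auto simp: ennreal_mult')
      finally show ?thesis using 3 by simp
    qed (cases "v = 0"; simp)
  qed
  finally show ?thesis .
qed

text \<open>The superlevel set of \<open>1 / (1 + N x powr m)\<close> at level \<open>v\<close> is a
  ball with volume proportional to \<open>((1 - v) / v) powr p\<close>. Against
  \<open>v powr (p + q - 1)\<close> this leaves the Beta integrand.\<close>

lemma nn_integral_one_plus_is_norm: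
  fixes m q :: real
  assumes m: "0 < m" and q: "0 < q"
  defines "p \<equiv> real CARD('n) / m"
  shows "(\<integral>\<^sup>+x. ennreal ((1 + N x powr m) powr (- (p + q))) \<partial>lborel)
    = ennreal (unit_ball_volume N * (p + q) * Beta q (p + 1))"
proof -
  define S where "S = p + q"
  have p: "0 < p" using m by (simp add: p_def)
  have S: "0 < S" using p q by (simp add: S_def)
  define \<rho> :: "real \<Rightarrow> real" where "\<rho> v = (1 / v - 1) powr (1 / m)" for v
  have [measurable]: "N \<in> borel_measurable borel" by (rule is_norm_borel_measurable)
  have pos: "0 < 1 + N x powr m" for x by (smt (verit) powr_ge_zero)
  have "(\<integral>\<^sup>+x. ennreal ((1 + N x powr m) powr (- S)) \<partial>lborel)
     = (\<integral>\<^sup>+x. ennreal ((1 / (1 + N x powr m)) powr S) \<partial>lborel)"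
    using pos by (simp add: powr_divide powr_minus_divide less_imp_le)
  also have "\<dots> = (\<integral>\<^sup>+v. ennreal (S * v powr (S - 1) * (unit_ball_volume N * \<rho> v ^ CARD('n))) * indicator {0..1} v \<partial>lborel)"
  proof (rule nn_integral_radial_powr)
    show "1 / (1 + N x powr m) \<le> 1" "0 < 1 / (1 + N x powr m)" for x
      using pos[of x] by auto
    fix v x assume v: "0 < v" "v \<le> (1::real)"
    have "v \<le> 1 / (1 + N x powr m) \<longleftrightarrow> N x powr m \<le> 1 / v - 1"
      using v pos[of x] by (simp add: field_simps)
    also have "\<dots> \<longleftrightarrow> N x \<le> \<rho> v"
    proof
      assume "N x powr m \<le> 1 / v - 1"
      then have "(N x powr m) powr (1 / m) \<le> (1 / v - 1) powr (1 / m)"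
        using m by (intro powr_mono2) auto
      then show "N x \<le> \<rho> v" using m is_norm_nonneg[of x] by (simp add: \<rho>_def powr_powr)
    next
      assume "N x \<le> \<rho> v"
      then have "N x powr m \<le> ((1 / v - 1) powr (1 / m)) powr m"
        using m is_norm_nonneg[of x] by (intro powr_mono2) (auto simp: \<rho>_def)
      then show "N x powr m \<le> 1 / v - 1" using v m by (simp add: powr_powr)
    qed
    finally show "v \<le> 1 / (1 + N x powr m) \<longleftrightarrow> N x \<le> \<rho> v" .
  qed (use S in \<open>auto simp: \<rho>_def\<close>)
  \<comment> \<open>The exponent is written \<open>p + 1 - 1\<close> to match the integral
    representation of \<open>Beta q (p + 1)\<close>.\<close>
  also have "\<dots> = (\<integral>\<^sup>+v. ennreal (unit_ball_volume N * S * (v powr (q - 1) * (1 - v) powr (p + 1 - 1))) * indicator {0..1} v \<partial>lborel)"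
  proof (rule nn_integral_cong)
    fix v :: real
    consider "v < 0 \<or> 1 < v" | "v = 0" | "0 < v" "v \<le> 1" by linarith
    then show "ennreal (S * v powr (S - 1) * (unit_ball_volume N * \<rho> v ^ CARD('n))) * indicator {0..1} v
      = ennreal (unit_ball_volume N * S * (v powr (q - 1) * (1 - v) powr (p + 1 - 1))) * indicator {0..1} v"
    proof cases
      case 3
      have "\<rho> v ^ CARD('n) = (1 / v - 1) powr p"
      proof (cases "v = 1")
        case False
        then have "0 < 1 / v - 1" using 3 by simp
        then show ?thesis unfolding \<rho>_def
          by (subst powr_realpow[symmetric]) (auto simp: powr_powr p_def)
      qed (simp add: \<rho>_def)
      also have "1 / v - 1 = (1 - v) / v" using 3 by (simp add: field_simps)
      also have "\<dots> powr p = (1 - v) powr p / v powr p" by (rule powr_divide)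
      finally have "v powr (S - 1) * \<rho> v ^ CARD('n) = v powr (S - 1) / v powr p * (1 - v) powr p"
        by simp
      also have "v powr (S - 1) / v powr p = v powr (q - 1)"
        by (simp add: powr_diff[symmetric] S_def)
      finally show ?thesis by (simp add: mult_ac)
    qed auto
  qed
  also have "\<dots> = ennreal (unit_ball_volume N * S * Beta q (p + 1))"
    by (intro nn_integral_has_integral_lebesgue' has_integral_mult_right has_integral_Beta_real)
       (use p q S unit_ball_volume_pos in auto)
  finally show ?thesis by (simp add: S_def)
qed

text \<open>Layer-cake again: the superlevel sets of \<open>max 1 (N x) powr (- m)\<close> have
  volume proportional to \<open>v powr (- p)\<close>, so only the integral of
  \<open>v powr (q - 1)\<close> over [0, 1] remains. For \<open>m = r + \<delta>\<close> and
  \<open>p + q = d / r\<close> this is the integral in \<open>kappa\<close>.\<close>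

lemma integral_max_1_is_norm:
  fixes m q :: real
  assumes m: "0 < m" and q: "0 < q"
  defines "p \<equiv> real CARD('n) / m"
  shows "(\<integral>x. max 1 (N x) powr (- m * (p + q)) \<partial>lborel) = unit_ball_volume N * (p + q) / q"
proof -
  define S where "S = p + q"
  have p: "0 < p" using m by (simp add: p_def)
  have S: "0 < S" using p q by (simp add: S_def)
  have [measurable]: "N \<in> borel_measurable borel" by (rule is_norm_borel_measurable)
  define \<rho> :: "real \<Rightarrow> real" where "\<rho> v = v powr (- 1 / m)" for v
  have "(\<integral>\<^sup>+x. ennreal (max 1 (N x) powr (- m * S)) \<partial>lborel)
     = (\<integral>\<^sup>+x. ennreal ((max 1 (N x) powr (- m)) powr S) \<partial>lborel)"
    by (simp add: powr_powr)
  also have "\<dots> = (\<integral>\<^sup>+v. ennreal (S * v powr (S - 1) * (unit_ball_volume N * \<rho> v ^ CARD('n))) * indicator {0..1} v \<partial>lborel)"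
  proof (rule nn_integral_radial_powr)
    show "max 1 (N x) powr (- m) \<le> 1" for x
      using powr_mono2'[of "-m" 1 "max 1 (N x)"] m by simp
    show "0 < max 1 (N x) powr (- m)" for x by simp
    fix v x assume v: "0 < v" "v \<le> (1::real)"
    \<comment> \<open>This lets the condition \<open>max 1 (N x) \<le> \<rho> v\<close> collapse to
      \<open>N x \<le> \<rho> v\<close>.\<close>
    have ge1: "1 \<le> \<rho> v" using powr_mono2'[of "- 1 / m" v 1] m v by (simp add: \<rho>_def)
    have "v \<le> max 1 (N x) powr (- m) \<longleftrightarrow> max 1 (N x) \<le> \<rho> v"
    proof
      assume "v \<le> max 1 (N x) powr (- m)"
      then have "(max 1 (N x) powr (- m)) powr (- 1 / m) \<le> v powr (- 1 / m)"
        using m v by (intro powr_mono2') auto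
      then show "max 1 (N x) \<le> \<rho> v" using m by (simp add: \<rho>_def powr_powr)
    next
      assume "max 1 (N x) \<le> \<rho> v"
      then have "\<rho> v powr (- m) \<le> max 1 (N x) powr (- m)"
        using m by (intro powr_mono2') auto
      then show "v \<le> max 1 (N x) powr (- m)" using v m by (simp add: \<rho>_def powr_powr)
    qed
    then show "v \<le> max 1 (N x) powr (- m) \<longleftrightarrow> N x \<le> \<rho> v" using ge1 by simp
  qed (use S in \<open>auto simp: \<rho>_def\<close>)
  also have "\<dots> = (\<integral>\<^sup>+v. ennreal (unit_ball_volume N * S * (v powr (q - 1))) * indicator {0..1} v \<partial>lborel)"
  proof (rule nn_integral_cong)
    fix v :: real
    consider "v < 0 \<or> 1 < v" | "v = 0" | "0 < v" "v \<le> 1" by linarith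
    then show "ennreal (S * v powr (S - 1) * (unit_ball_volume N * \<rho> v ^ CARD('n))) * indicator {0..1} v
      = ennreal (unit_ball_volume N * S * (v powr (q - 1))) * indicator {0..1} v"
    proof cases
      case 3
      have "\<rho> v ^ CARD('n) = v powr (- p)"
        using 3 by (simp add: \<rho>_def powr_realpow[symmetric] powr_powr p_def)
      then have "v powr (S - 1) * \<rho> v ^ CARD('n) = v powr (q - 1)"
        by (simp add: powr_add[symmetric] S_def)
      then show ?thesis by (simp add: mult_ac)
    qed auto
  qed
  also have "\<dots> = ennreal (unit_ball_volume N * S * (1 powr (q - 1 + 1) / (q - 1 + 1)))"
    by (intro nn_integral_has_integral_lebesgue' has_integral_mult_right has_integral_powr_from_0)
       (use q S unit_ball_volume_pos in auto)
  finally have "(\<integral>\<^sup>+x. ennreal (max 1 (N x) powr (- m * S)) \<partial>lborel) = ennreal (unit_ball_volume N * S / q)"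
    by simp
  then show ?thesis unfolding S_def[symmetric]
    using q S unit_ball_volume_pos by (subst integral_eq_nn_integral) auto
qed

end

subsection \<open>One greedy step\<close>

definition min_dist :: "(real^'n \<Rightarrow> real) \<Rightarrow> (real^'n) set \<Rightarrow> real^'n \<Rightarrow> real" where
  "min_dist N A \<xi> = Min ((\<lambda>x. N (\<xi> - x)) ` A)"

lemma min_dist_le: "finite A \<Longrightarrow> x \<in> A \<Longrightarrow> min_dist N A \<xi> \<le> N (\<xi> - x)"
  by (simp add: min_dist_def)

lemma min_dist_attained:
  assumes "finite A" "A \<noteq> {}"
  obtains x where "x \<in> A" "min_dist N A \<xi> = N (\<xi> - x)"
proof -
  have "min_dist N A \<xi> \<in> (\<lambda>x. N (\<xi> - x)) ` A"
    unfolding min_dist_def by (rule Min_in) (use assms in auto)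
  then show ?thesis using that by blast
qed

context
  fixes N :: "real^'n \<Rightarrow> real"
  assumes norm: "is_norm N"
begin

lemmas is_norm_facts = is_norm_nonneg[OF norm] is_norm_zero_iff[OF norm] is_norm_scale[OF norm] is_norm_diff_commute[OF norm]

lemma min_dist_nonneg:
  assumes "finite A" "A \<noteq> {}"
  shows "0 \<le> min_dist N A \<xi>"
  using assms by (auto simp: min_dist_def is_norm_facts)

lemma Min_powr_eq_min_dist:
  assumes A: "finite A" "A \<noteq> {}" and s: "0 < s"
  shows "Min ((\<lambda>x. N (\<xi> - x) powr s) ` A) = min_dist N A \<xi> powr s"
proof (rule Min_eqI)
  obtain x where "x \<in> A" "min_dist N A \<xi> = N (\<xi> - x)" using min_dist_attained[OF A] .
  then show "min_dist N A \<xi> powr s \<in> (\<lambda>x. N (\<xi> - x) powr s) ` A" by auto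
qed (use A s in \<open>auto intro!: powr_mono2 min_dist_nonneg min_dist_le\<close>)

lemma min_dist_measurable [measurable]:
  assumes "finite A"
  shows "min_dist N A \<in> borel_measurable borel"
proof -
  have [measurable]: "N \<in> borel_measurable borel" by (rule is_norm_borel_measurable[OF norm])
  show ?thesis unfolding min_dist_def[abs_def] using assms by measurable
qed

lemma min_dist_insert:
  assumes "finite A" "A \<noteq> {}"
  shows "min_dist N (A \<union> {y}) \<xi> = min (min_dist N A \<xi>) (N (\<xi> - y))"
  using assms by (simp add: min_dist_def min.commute)

lemma min_dist_dilate:
  assumes A: "finite A" "A \<noteq> {}" and \<theta>: "0 < \<theta>"
  shows "min_dist N (dilate \<theta> \<mu> ` A) (dilate \<theta> \<mu> x) = \<theta> * min_dist N A x"
proof -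
  have "N (dilate \<theta> \<mu> x - dilate \<theta> \<mu> y) = \<theta> * N (x - y)" for y
  proof -
    have "dilate \<theta> \<mu> x - dilate \<theta> \<mu> y = \<theta> *\<^sub>R (x - y)" by (simp add: dilate_def algebra_simps)
    then show ?thesis using \<theta> by (simp add: is_norm_facts)
  qed
  then have "min_dist N (dilate \<theta> \<mu> ` A) (dilate \<theta> \<mu> x) = Min ((\<lambda>t. \<theta> * t) ` (\<lambda>y. N (x - y)) ` A)"
    by (simp add: min_dist_def image_image)
  also have "\<dots> = \<theta> * min_dist N A x"
    unfolding min_dist_def using A \<theta>
    by (intro mono_Min_commute[symmetric]) (auto intro!: monoI mult_left_mono)
  finally show ?thesis .
qed

lemma quant_error_eq:
  assumes "finite A" "A \<noteq> {}" "0 < s"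
  shows "quant_error N s A P = (\<integral>\<xi>. min_dist N A \<xi> powr s \<partial>P) powr (1 / s)"
  using assms by (simp add: quant_error_def Min_powr_eq_min_dist)

lemma integrable_is_norm_diff_powr:
  fixes P :: "(real^'n) measure"
  assumes P: "finite_measure P" "sets P = sets borel"
    and s: "0 < s" "s \<le> m" and moment: "integrable P (\<lambda>\<xi>. N \<xi> powr m)"
  shows "integrable P (\<lambda>\<xi>. N (\<xi> - x) powr s)"
proof (rule Bochner_Integration.integrable_bound)
  interpret finite_measure P by (rule P)
  note [measurable_cong] = P(2)
  have [measurable]: "N \<in> borel_measurable borel" by (rule is_norm_borel_measurable[OF norm])
  \<comment> \<open>The 1 dominates the power \<open>s\<close> where
    \<open>N (\<xi> - x) \<le> 1\<close>. Elsewhere the power \<open>m\<close> dominates, and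
    bounding \<open>N (\<xi> - x)\<close> by twice a maximum works for every \<open>m > 0\<close>,
    including \<open>m < 1\<close> where convexity fails.\<close>
  let ?B = "\<lambda>\<xi>. 1 + 2 powr m * (N \<xi> powr m + N x powr m)"
  show "integrable P ?B" using moment by simp
  show "(\<lambda>\<xi>. N (\<xi> - x) powr s) \<in> borel_measurable P" by measurable
  have "N (\<xi> - x) powr s \<le> ?B \<xi>" for \<xi>
  proof -
    have "N (\<xi> - x) powr s \<le> 1 + N (\<xi> - x) powr m"
    proof (cases "N (\<xi> - x) \<le> 1")
      case True
      then have "N (\<xi> - x) powr s \<le> 1 powr s" using s by (intro powr_mono2) (auto simp: is_norm_facts)
      then show ?thesis by (smt (verit) powr_ge_zero powr_one_eq_one)
    next
      case False
      then have "N (\<xi> - x) powr s \<le> N (\<xi> - x) powr m" using s by (intro powr_mono) auto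
      then show ?thesis by simp
    qed
    moreover have "N (\<xi> - x) powr m \<le> (2 * max (N \<xi>) (N x)) powr m"
    proof (rule powr_mono2)
      have "N (\<xi> - x) \<le> N \<xi> + N x"
        using is_norm_triangle[OF norm, of \<xi> "- x"] by (simp add: is_norm_minus[OF norm])
      then show "N (\<xi> - x) \<le> 2 * max (N \<xi>) (N x)" by linarith
    qed (use s in \<open>auto simp: is_norm_facts\<close>)
    moreover have "(2 * max (N \<xi>) (N x)) powr m \<le> 2 powr m * (N \<xi> powr m + N x powr m)"
      by (cases "N \<xi> \<le> N x") (simp_all add: powr_mult max_def)
    ultimately show ?thesis by linarith
  qed
  then show "AE \<xi> in P. norm (N (\<xi> - x) powr s) \<le> norm (?B \<xi>)"
    by (auto intro!: always_eventually order_trans[OF _ abs_ge_self])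
qed

lemma integrable_min_dist_powr:
  assumes P: "sets P = sets borel"
    and A: "finite A" "x \<in> A" and s: "0 < s" and int: "integrable P (\<lambda>\<xi>. N (\<xi> - x) powr s)"
  shows "integrable P (\<lambda>\<xi>. min_dist N A \<xi> powr s)"
proof (rule Bochner_Integration.integrable_bound[OF int])
  note [measurable_cong] = P
  have [measurable]: "min_dist N A \<in> borel_measurable borel" by (rule min_dist_measurable[OF A(1)])
  show "(\<lambda>\<xi>. min_dist N A \<xi> powr s) \<in> borel_measurable P" by measurable
  have "min_dist N A \<xi> powr s \<le> N (\<xi> - x) powr s" for \<xi>
    using A s min_dist_nonneg[of A] by (intro powr_mono2 min_dist_le) auto
  then show "AE \<xi> in P. norm (min_dist N A \<xi> powr s) \<le> norm (N (\<xi> - x) powr s)" by simp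
qed

lemma greedy_step:
  assumes greedy: "greedy_quantization N r P a" and r: "0 < r" and n: "1 \<le> n"
  shows "(\<integral>\<xi>. min_dist N (a ` {1..Suc n}) \<xi> powr r \<partial>P)
    \<le> (\<integral>\<xi>. min (min_dist N (a ` {1..n}) \<xi>) (N (\<xi> - y)) powr r \<partial>P)"
proof -
  let ?A = "a ` {1..n}"
  have A: "finite ?A" "?A \<noteq> {}" using n by auto
  have "quant_error N r (?A \<union> {a (Suc n)}) P \<le> quant_error N r (?A \<union> {y}) P"
    using greedy by (auto simp: greedy_quantization_def is_arg_min_def not_less)
  then have "(\<integral>\<xi>. min_dist N (?A \<union> {a (Suc n)}) \<xi> powr r \<partial>P) powr (1 / r)
      \<le> (\<integral>\<xi>. min_dist N (?A \<union> {y}) \<xi> powr r \<partial>P) powr (1 / r)"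
    using A r by (simp add: quant_error_eq)
  \<comment> \<open>The outer power \<open>1 / r\<close> is strictly increasing on nonnegative reals
    and can be removed.\<close>
  then have "(\<integral>\<xi>. min_dist N (?A \<union> {a (Suc n)}) \<xi> powr r \<partial>P)
      \<le> (\<integral>\<xi>. min_dist N (?A \<union> {y}) \<xi> powr r \<partial>P)"
    by (rule contrapos_pp) (use r in \<open>auto simp: not_le intro!: powr_less_mono2\<close>)
  moreover have "?A \<union> {a (Suc n)} = a ` {1..Suc n}" using n by (auto simp: atLeastAtMostSuc_conv)
  ultimately show ?thesis using min_dist_insert[OF A] by simp
qed

text \<open>Every candidate \<open>y\<close> bounds \<open>E n - E (Suc n)\<close> from below, so
  the weighted average over \<open>y\<close> with weight \<open>h\<close> does too. After exchanging
  the integrals, each \<open>\<xi>\<close> sees the ball of candidates within \<open>b\<close> times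
  its distance. There \<open>h\<close> is at least \<open>g \<xi>\<close>, and the volume of the
  ball supplies the additional power \<open>CARD('n)\<close> of the distance.\<close>

lemma greedy_decrease:
  fixes P :: "(real^'n) measure" and h g :: "real^'n \<Rightarrow> real"
  assumes P: "prob_space P" "sets P = sets borel"
    and greedy: "greedy_quantization N r P a" and r: "0 < r" and n: "1 \<le> n"
    and int: "integrable P (\<lambda>\<xi>. N (\<xi> - a 1) powr r)"
    and b: "0 < b" "b < 1"
    and h: "h \<in> borel_measurable borel" and g: "g \<in> borel_measurable borel" "\<And>\<xi>. 0 \<le> g \<xi>"
    and le: "\<And>\<xi> y. N (y - \<xi>) \<le> b * min_dist N (a ` {1..n}) \<xi> \<Longrightarrow> g \<xi> \<le> h y"
  defines "E \<equiv> \<lambda>k. \<integral>\<xi>. min_dist N (a ` {1..k}) \<xi> powr r \<partial>P"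
  shows "(\<integral>\<^sup>+\<xi>. ennreal ((1 - b powr r) * b ^ CARD('n) * unit_ball_volume N *
        (g \<xi> * min_dist N (a ` {1..n}) \<xi> powr (r + real CARD('n)))) \<partial>P)
      \<le> ennreal (E n - E (Suc n)) * (\<integral>\<^sup>+y. ennreal (h y) \<partial>lborel)"
proof -
  interpret P: prob_space P by (rule P)
  interpret pair_sigma_finite lborel P ..
  note [measurable_cong] = P(2)
  define D where "D = min_dist N (a ` {1..n})"
  have A: "finite (a ` {1..n})" "a ` {1..n} \<noteq> {}" "a 1 \<in> a ` {1..n}" using n by auto
  have [measurable]: "N \<in> borel_measurable borel" "D \<in> borel_measurable borel"
      "h \<in> borel_measurable borel" "g \<in> borel_measurable borel"
    using is_norm_borel_measurable[OF norm] min_dist_measurable[OF A(1)] h g by (auto simp: D_def)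
  have D0: "0 \<le> D \<xi>" for \<xi> using min_dist_nonneg[OF A(1,2)] by (simp add: D_def)
  have intD: "integrable P (\<lambda>\<xi>. D \<xi> powr r)"
    unfolding D_def using integrable_min_dist_powr[OF P(2) A(1,3) r int] .
  have br: "b powr r < 1" using powr_less_mono2[of r b 1] r b by simp
  let ?V = "unit_ball_volume N"
  let ?K = "\<lambda>\<xi>. (1 - b powr r) * D \<xi> powr r"
  have K0: "0 \<le> ?K \<xi>" for \<xi> using br by simp
  \<comment> \<open>Adding \<open>y\<close> leaves a distance of at most \<open>b * D \<xi>\<close>
    on the indicated set, so the integrand drops there by at least
    \<open>(1 - b powr r) * D \<xi> powr r\<close>; elsewhere it does not increase.\<close>
  have candidate: "(\<integral>\<^sup>+\<xi>. ennreal (?K \<xi>) * indicator {\<xi>. N (y - \<xi>) \<le> b * D \<xi>} \<xi> \<partial>P) \<le> ennreal (E n - E (Suc n))" for y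
  proof -
    let ?m = "\<lambda>\<xi>. min (D \<xi>) (N (\<xi> - y)) powr r"
    have le_m: "?m \<xi> \<le> D \<xi> powr r" for \<xi>
      using r D0 by (intro powr_mono2) (auto simp: is_norm_facts)
    have intm: "integrable P ?m"
      by (rule Bochner_Integration.integrable_bound[OF intD]) (use le_m in auto)
    have "(\<integral>\<^sup>+\<xi>. ennreal (?K \<xi>) * indicator {\<xi>. N (y - \<xi>) \<le> b * D \<xi>} \<xi> \<partial>P)
        \<le> (\<integral>\<^sup>+\<xi>. ennreal (D \<xi> powr r - ?m \<xi>) \<partial>P)"
    proof (rule nn_integral_mono)
      fix \<xi>
      have "?K \<xi> \<le> D \<xi> powr r - ?m \<xi>" if "N (y - \<xi>) \<le> b * D \<xi>"
      proof -
        have "?m \<xi> \<le> (b * D \<xi>) powr r"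
          using that r D0[of \<xi>] by (intro powr_mono2) (auto simp: is_norm_nonneg[OF norm] is_norm_facts(4)[of \<xi> y])
        also have "\<dots> = b powr r * D \<xi> powr r" by (rule powr_mult)
        finally show ?thesis by (simp add: algebra_simps)
      qed
      then show "ennreal (?K \<xi>) * indicator {\<xi>. N (y - \<xi>) \<le> b * D \<xi>} \<xi> \<le> ennreal (D \<xi> powr r - ?m \<xi>)"
        by (auto simp: indicator_def intro: ennreal_leI)
    qed
    also have "\<dots> = ennreal (\<integral>\<xi>. D \<xi> powr r - ?m \<xi> \<partial>P)"
      by (rule nn_integral_eq_integral) (use intD intm le_m in auto)
    also have "\<dots> \<le> ennreal (E n - E (Suc n))"
      using greedy_step[OF greedy r n, of y] intD intm by (auto simp: E_def D_def intro!: ennreal_leI)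
    finally show ?thesis .
  qed
  have "(\<integral>\<^sup>+\<xi>. ennreal ((1 - b powr r) * b ^ CARD('n) * ?V * (g \<xi> * D \<xi> powr (r + real CARD('n)))) \<partial>P)
      = (\<integral>\<^sup>+\<xi>. ennreal (g \<xi> * ?K \<xi>) * emeasure lborel {y. N (y - \<xi>) \<le> b * D \<xi>} \<partial>P)"
  proof (rule nn_integral_cong)
    fix \<xi>
    have "ennreal (g \<xi> * ?K \<xi>) * emeasure lborel {y. N (y - \<xi>) \<le> b * D \<xi>}
        = ennreal (g \<xi> * ?K \<xi> * (?V * (b * D \<xi>) ^ CARD('n)))"
      using emeasure_is_norm_ball[OF norm, of "b * D \<xi>" \<xi>] b D0 g K0 by (simp add: ennreal_mult'[symmetric])
    also have "D \<xi> powr (r + real CARD('n)) = D \<xi> powr r * D \<xi> ^ CARD('n)"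
      using D0[of \<xi>] by (cases "D \<xi> = 0") (auto simp: powr_add powr_realpow)
    then have "g \<xi> * ?K \<xi> * (?V * (b * D \<xi>) ^ CARD('n))
        = (1 - b powr r) * b ^ CARD('n) * ?V * (g \<xi> * D \<xi> powr (r + real CARD('n)))"
      by (simp add: power_mult_distrib)
    finally show "ennreal ((1 - b powr r) * b ^ CARD('n) * ?V * (g \<xi> * D \<xi> powr (r + real CARD('n))))
        = ennreal (g \<xi> * ?K \<xi>) * emeasure lborel {y. N (y - \<xi>) \<le> b * D \<xi>}" ..
  qed
  also have "\<dots> = (\<integral>\<^sup>+\<xi>. (\<integral>\<^sup>+y. ennreal (g \<xi> * ?K \<xi>) * indicator {y. N (y - \<xi>) \<le> b * D \<xi>} y \<partial>lborel) \<partial>P)"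
    by (intro nn_integral_cong nn_integral_cmult_indicator[symmetric]) measurable
  \<comment> \<open>The same inequality is now read as a condition on \<open>\<xi>\<close> for fixed
    \<open>y\<close>, and \<open>g \<xi>\<close> is replaced by \<open>h y\<close>, which leaves the
    inner integral once the order is exchanged.\<close>
  also have "\<dots> \<le> (\<integral>\<^sup>+\<xi>. (\<integral>\<^sup>+y. ennreal (h y) * (ennreal (?K \<xi>) * indicator {\<xi>. N (y - \<xi>) \<le> b * D \<xi>} \<xi>) \<partial>lborel) \<partial>P)"
  proof (intro nn_integral_mono)
    fix \<xi> y
    show "ennreal (g \<xi> * ?K \<xi>) * indicator {y. N (y - \<xi>) \<le> b * D \<xi>} y
        \<le> ennreal (h y) * (ennreal (?K \<xi>) * indicator {\<xi>. N (y - \<xi>) \<le> b * D \<xi>} \<xi>)"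
    proof (cases "N (y - \<xi>) \<le> b * D \<xi>")
      case True
      then have "ennreal (g \<xi>) * ennreal (?K \<xi>) \<le> ennreal (h y) * ennreal (?K \<xi>)"
        using le[of y \<xi>] by (intro mult_right_mono ennreal_leI) (auto simp: D_def)
      then show ?thesis using True g(2)[of \<xi>] by (simp add: ennreal_mult')
    qed simp
  qed
  also have "\<dots> = (\<integral>\<^sup>+y. (\<integral>\<^sup>+\<xi>. ennreal (h y) * (ennreal (?K \<xi>) * indicator {\<xi>. N (y - \<xi>) \<le> b * D \<xi>} \<xi>) \<partial>P) \<partial>lborel)"
    unfolding indicator_def mem_Collect_eq by (rule Fubini') measurable
  also have "\<dots> = (\<integral>\<^sup>+y. ennreal (h y) * (\<integral>\<^sup>+\<xi>. ennreal (?K \<xi>) * indicator {\<xi>. N (y - \<xi>) \<le> b * D \<xi>} \<xi> \<partial>P) \<partial>lborel)"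
    by (intro nn_integral_cong nn_integral_cmult) measurable
  also have "\<dots> \<le> (\<integral>\<^sup>+y. ennreal (h y) * ennreal (E n - E (Suc n)) \<partial>lborel)"
    by (intro nn_integral_mono mult_left_mono candidate) auto
  also have "\<dots> = ennreal (E n - E (Suc n)) * (\<integral>\<^sup>+y. ennreal (h y) \<partial>lborel)"
    by (simp add: nn_integral_multc mult.commute)
  finally show ?thesis by (simp add: D_def)
qed

end

subsection \<open>Convergence rate of greedy quantization\<close>

context
  fixes N :: "real^'n \<Rightarrow> real" and P :: "(real^'n) measure" and r \<delta> b :: real and a :: "nat \<Rightarrow> real^'n"
  assumes norm: "is_norm N" and P: "prob_space P" "sets P = sets borel"
    and r: "0 < r" and \<delta>: "0 < \<delta>" and b: "0 < b" "b < 1"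
    and moment: "integrable P (\<lambda>\<xi>. N \<xi> powr (r + \<delta>))"
    and greedy: "greedy_quantization N r P a"
begin

text \<open>\<open>greedy_decrease\<close> with the weight from the overview bounds the integral of
  \<open>g \<xi> * D \<xi> powr (r + d)\<close> by the decrease of \<open>E\<close>. Hoelder's
  inequality then recovers \<open>E n\<close>, at the price of \<open>G\<close>, the integral of
  \<open>w\<close>, where \<open>g\<close> is \<open>w powr (- S)\<close>. The scale
  \<open>\<tau>\<close> stays free so that it can be optimised later.\<close>

lemma greedy_recursion:
  fixes \<tau> J :: real
  defines "d \<equiv> real CARD('n)"
    and "E \<equiv> \<lambda>k. \<integral>\<xi>. min_dist N (a ` {1..k}) \<xi> powr r \<partial>P"
    and "G \<equiv> 1 + ((1 + b) / \<tau>) powr (r + \<delta>) * (\<integral>\<xi>. N (\<xi> - a 1) powr (r + \<delta>) \<partial>P)"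
  assumes \<tau>: "0 < \<tau>" and n: "1 \<le> n" and J0: "0 \<le> J"
    and J: "(\<integral>\<^sup>+x. ennreal ((1 + N x powr (r + \<delta>)) powr (- (d / r))) \<partial>lborel) = ennreal J"
  shows "(1 - b powr r) * b ^ CARD('n) * unit_ball_volume N * E n powr (1 + d / r)
    \<le> (E n - E (Suc n)) * (\<tau> ^ CARD('n) * J) * G powr (d / r)"
proof -
  interpret P: prob_space P by (rule P)
  note [measurable_cong] = P(2)
  define m where "m = r + \<delta>"
  have m: "0 < m" "r < m" using r \<delta> by (auto simp: m_def)
  have d: "0 < d" by (simp add: d_def)
  define S where "S = d / r"
  have S: "0 < S" using d r by (simp add: S_def)
  define D where "D = min_dist N (a ` {1..n})"
  have A: "finite (a ` {1..n})" "a ` {1..n} \<noteq> {}" "a 1 \<in> a ` {1..n}" using n by auto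
  have [measurable]: "N \<in> borel_measurable borel" "D \<in> borel_measurable borel"
    using is_norm_borel_measurable[OF norm] min_dist_measurable[OF norm A(1)] by (auto simp: D_def)
  have D0: "0 \<le> D \<xi>" for \<xi> using min_dist_nonneg[OF norm A(1,2)] by (simp add: D_def)
  have intm: "integrable P (\<lambda>\<xi>. N (\<xi> - a 1) powr m)"
    using integrable_is_norm_diff_powr[OF norm P.finite_measure_axioms P(2) m(1) order_refl] moment
    by (simp add: m_def)
  have intr: "integrable P (\<lambda>\<xi>. N (\<xi> - a 1) powr r)"
    using integrable_is_norm_diff_powr[OF norm P.finite_measure_axioms P(2) r, of m] moment m by (simp add: m_def)
  have intD: "integrable P (\<lambda>\<xi>. D \<xi> powr r)"
    unfolding D_def using integrable_min_dist_powr[OF norm P(2) A(1,3) r intr] .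
  have N0: "0 \<le> N x" for x by (rule is_norm_nonneg[OF norm])
  have pos: "0 < 1 + t powr m" for t :: real by (smt (verit) powr_ge_zero)
  define w where "w \<xi> = 1 + ((1 + b) / \<tau> * N (\<xi> - a 1)) powr m" for \<xi>
  have w: "1 \<le> w \<xi>" for \<xi> by (simp add: w_def)
  have [measurable]: "w \<in> borel_measurable borel" unfolding w_def[abs_def] by measurable
  have w_eq: "w \<xi> = 1 + ((1 + b) / \<tau>) powr m * N (\<xi> - a 1) powr m" for \<xi>
    by (simp only: w_def powr_mult)
  have intw: "integrable P w" unfolding w_eq[abs_def] using intm by simp
  have G: "(\<integral>\<xi>. w \<xi> \<partial>P) = G"
    unfolding w_eq G_def m_def[symmetric] using intm by (simp add: P.prob_space)
  have G1: "1 \<le> G" by (simp add: G_def integral_nonneg)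
  define h where "h y = (1 + (N (y - a 1) / \<tau>) powr m) powr (- S)" for y
  define g where "g \<xi> = w \<xi> powr (- S)" for \<xi>
  have [measurable]: "h \<in> borel_measurable borel" "g \<in> borel_measurable borel"
    unfolding h_def[abs_def] g_def[abs_def] by measurable
  let ?c = "(1 - b powr r) * b ^ CARD('n) * unit_ball_volume N"
  have br: "b powr r < 1" using powr_less_mono2[of r b 1] r b by simp
  have c: "0 < ?c" using br b unit_ball_volume_pos[OF norm] by simp
  have "(\<integral>\<^sup>+\<xi>. ennreal (?c * (g \<xi> * D \<xi> powr (r + d))) \<partial>P)
      \<le> ennreal (E n - E (Suc n)) * (\<integral>\<^sup>+y. ennreal (h y) \<partial>lborel)"
    unfolding D_def d_def E_def
  proof (rule greedy_decrease[OF norm P greedy r n intr b])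
    \<comment> \<open>Since \<open>a 1\<close> is one of the points,
      \<open>D \<xi> \<le> N (\<xi> - a 1)\<close>. Hence \<open>y\<close> is at most
      \<open>(1 + b) * N (\<xi> - a 1)\<close> away from \<open>a 1\<close>, which explains the
      factor \<open>1 + b\<close> in \<open>w\<close>.\<close>
    fix \<xi> y assume "N (y - \<xi>) \<le> b * min_dist N (a ` {1..n}) \<xi>"
    also have "\<dots> \<le> b * N (\<xi> - a 1)" using b min_dist_le[OF A(1,3)] by (intro mult_left_mono) auto
    finally have "N (y - a 1) \<le> (1 + b) * N (\<xi> - a 1)"
      using is_norm_triangle_diff[OF norm, of y "a 1" \<xi>] by (simp add: algebra_simps)
    then have "N (y - a 1) / \<tau> \<le> (1 + b) / \<tau> * N (\<xi> - a 1)"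
      using \<tau> by (simp add: field_simps)
    then show "g \<xi> \<le> h y"
      unfolding g_def h_def w_def using S m N0 \<tau> pos
      by (intro powr_mono2' add_left_mono powr_mono2) auto
  qed (auto simp: g_def)
  also have "(\<integral>\<^sup>+y. ennreal (h y) \<partial>lborel)
      = ennreal (\<bar>\<tau>\<bar> ^ DIM(real^'n)) * (\<integral>\<^sup>+x. ennreal (h (a 1 + \<tau> *\<^sub>R x)) \<partial>lborel)"
    by (rule nn_integral_lborel_affine) (use \<tau> in simp, measurable)
  also have "(\<lambda>x. ennreal (h (a 1 + \<tau> *\<^sub>R x))) = (\<lambda>x. ennreal ((1 + N x powr m) powr (- S)))"
    using \<tau> by (simp add: h_def is_norm_scale[OF norm])
  also have "(\<integral>\<^sup>+x. ennreal ((1 + N x powr m) powr (- S)) \<partial>lborel) = ennreal J"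
    using J by (simp add: m_def S_def)
  also have "ennreal (E n - E (Suc n)) * (ennreal (\<bar>\<tau>\<bar> ^ DIM(real^'n)) * ennreal J)
      = ennreal ((E n - E (Suc n)) * (\<tau> ^ CARD('n) * J))"
    using \<tau> J0 by (simp add: ennreal_mult'' ennreal_mult)
  finally have bound: "(\<integral>\<^sup>+\<xi>. ennreal (?c * (g \<xi> * D \<xi> powr (r + d))) \<partial>P)
      \<le> ennreal ((E n - E (Suc n)) * (\<tau> ^ CARD('n) * J))" .
  have g0: "0 \<le> g \<xi>" for \<xi> by (simp add: g_def)
  \<comment> \<open>Integrability comes from the finite bound just obtained for the nonnegative
    integral.\<close>
  have "integrable P (\<lambda>\<xi>. ?c * (g \<xi> * D \<xi> powr (r + d)))"
    by (rule integrableI_nonneg)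
       (use c g0 bound in \<open>auto intro: order.strict_trans1 simp: le_less_trans[OF bound] simp del: mult_pos_pos\<close>)
  then have intgD: "integrable P (\<lambda>\<xi>. g \<xi> * D \<xi> powr (r + d))"
    using c b integrable_mult_left_iff[of P ?c] by auto
  \<comment> \<open>The candidate \<open>a 1\<close> is already present, so comparing with it shows
    that \<open>E\<close> does not increase. The sign is needed to pass from extended to real
    numbers.\<close>
  have decr: "0 \<le> E n - E (Suc n)"
  proof -
    have "E (Suc n) \<le> (\<integral>\<xi>. min (min_dist N (a ` {1..n}) \<xi>) (N (\<xi> - a 1)) powr r \<partial>P)"
      unfolding E_def by (rule greedy_step[OF norm greedy r n])
    also have "\<dots> = E n" using min_dist_le[OF A(1,3)] by (simp add: min_absorb1 E_def)
    finally show ?thesis by simp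
  qed
  have gD: "?c * (\<integral>\<xi>. g \<xi> * D \<xi> powr (r + d) \<partial>P) \<le> (E n - E (Suc n)) * (\<tau> ^ CARD('n) * J)"
  proof -
    have "ennreal (\<integral>\<xi>. ?c * (g \<xi> * D \<xi> powr (r + d)) \<partial>P)
        = (\<integral>\<^sup>+\<xi>. ennreal (?c * (g \<xi> * D \<xi> powr (r + d))) \<partial>P)"
      by (rule nn_integral_eq_integral[symmetric]) (use intgD c g0 in auto)
    also note bound
    finally have "(\<integral>\<xi>. ?c * (g \<xi> * D \<xi> powr (r + d)) \<partial>P) \<le> (E n - E (Suc n)) * (\<tau> ^ CARD('n) * J)"
      by (rule ennreal_le_iff[THEN iffD1, rotated]) (use decr \<tau> J0 in auto)
    then show ?thesis by simp
  qed
  \<comment> \<open>This exponent is \<open>r / (r + d)\<close>: it turns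
    \<open>D \<xi> powr (r + d)\<close> into \<open>D \<xi> powr r\<close>, and makes
    \<open>g \<xi> powr \<alpha>\<close> cancel against
    \<open>w \<xi> powr (1 - \<alpha>)\<close>.\<close>
  define \<alpha> where "\<alpha> = 1 / (1 + S)"
  have \<alpha>: "0 < \<alpha>" "\<alpha> < 1" using S by (auto simp: \<alpha>_def)
  have \<alpha>S: "\<alpha> * S = 1 - \<alpha>" using S by (simp add: \<alpha>_def field_simps)
  have "(r + d) = r * (1 + S)" using r by (simp add: S_def field_simps)
  then have \<alpha>r: "(r + d) * \<alpha> = r" using S by (simp add: \<alpha>_def)
  have "E n = (\<integral>\<xi>. (g \<xi> * D \<xi> powr (r + d)) powr \<alpha> * w \<xi> powr (1 - \<alpha>) \<partial>P)"
    unfolding E_def D_def[symmetric]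
  proof (rule Bochner_Integration.integral_cong)
    fix \<xi>
    have "(g \<xi> * D \<xi> powr (r + d)) powr \<alpha> = g \<xi> powr \<alpha> * D \<xi> powr r"
      by (simp add: powr_mult powr_powr \<alpha>r)
    also have "g \<xi> powr \<alpha> = w \<xi> powr (- (1 - \<alpha>))"
      using \<alpha>S by (simp add: g_def powr_powr mult.commute)
    finally show "D \<xi> powr r = (g \<xi> * D \<xi> powr (r + d)) powr \<alpha> * w \<xi> powr (1 - \<alpha>)"
      using w[of \<xi>] by (simp add: mult.assoc powr_add[symmetric])
  qed simp
  also have "\<dots> \<le> (\<integral>\<xi>. g \<xi> * D \<xi> powr (r + d) \<partial>P) powr \<alpha> * (\<integral>\<xi>. w \<xi> \<partial>P) powr (1 - \<alpha>)"
    by (rule Holder_powr(2)[OF \<alpha> intgD intw]) (use g0 w in \<open>auto intro: order_trans[OF zero_le_one]\<close>)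
  finally have "E n powr (1 + S) \<le> ((\<integral>\<xi>. g \<xi> * D \<xi> powr (r + d) \<partial>P) powr \<alpha> * G powr (1 - \<alpha>)) powr (1 + S)"
    unfolding G using S by (intro powr_mono2) (auto simp: E_def)
  also have "\<dots> = (\<integral>\<xi>. g \<xi> * D \<xi> powr (r + d) \<partial>P) * G powr S"
  proof -
    have "\<alpha> * (1 + S) = 1" "(1 - \<alpha>) * (1 + S) = S" using S by (auto simp: \<alpha>_def field_simps)
    moreover have "0 \<le> (\<integral>\<xi>. g \<xi> * D \<xi> powr (r + d) \<partial>P)" using g0 by simp
    ultimately show ?thesis by (simp add: powr_mult powr_powr)
  qed
  finally have "?c * E n powr (1 + S) \<le> ?c * ((\<integral>\<xi>. g \<xi> * D \<xi> powr (r + d) \<partial>P) * G powr S)"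
    using c by (intro mult_left_mono) auto
  also have "\<dots> \<le> (E n - E (Suc n)) * (\<tau> ^ CARD('n) * J) * G powr S"
    using mult_right_mono[OF gD, of "G powr S"] by (simp add: mult.assoc)
  finally show ?thesis by (simp add: S_def)
qed

text \<open>The recursion with the best \<open>\<tau>\<close> is fed into
  \<open>recursive_decrease_bound\<close> with exponent \<open>S = d / r\<close>. The Beta bound
  cancels the powers of \<open>r\<close>, \<open>\<delta>\<close> and \<open>m\<close>, leaving
  \<open>(S + 1) / q\<close>, which is compared with the integral \<open>I\<close> of
  \<open>kappa\<close>.\<close>

lemma greedy_Pierce:
  assumes n: "2 \<le> n"
  defines "d \<equiv> real CARD('n)"
    and "m \<equiv> r + \<delta>"
  shows "(\<integral>\<xi>. min_dist N (a ` {1..n}) \<xi> powr r \<partial>P) powr (1 / r)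
    \<le> 2 powr (1 / d) * unit_ball_volume N powr (- 1 / d) * (r / d) powr (r / (d * (d + r)))
      * ((1 + b) * ((1 - b powr r) * b ^ CARD('n)) powr (- 1 / d))
      * (\<integral>x. max 1 (N x) powr (- d * (1 + \<delta> / r)) \<partial>lborel) powr (1 / d)
      * (\<integral>\<xi>. N (\<xi> - a 1) powr m \<partial>P) powr (1 / m) * (real n - 1) powr (- 1 / d)"
proof -
  interpret P: prob_space P by (rule P)
  have m: "0 < m" "r < m" using r \<delta> by (auto simp: m_def)
  have d: "0 < d" by (simp add: d_def)
  define S where "S = d / r"
  \<comment> \<open>Parameters for which both radial integrals apply with exponent
    \<open>p + q = d / r\<close>: the weight has integral \<open>J\<close> and the function in
    \<open>kappa\<close> has integral \<open>I = V * S / q\<close>.\<close>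
  define p where "p = d / m"
  define q where "q = d * \<delta> / (r * m)"
  have S: "0 < S" and p: "0 < p" and q: "0 < q" using d r m \<delta> by (auto simp: S_def p_def q_def)
  have Spq: "p + q = S"
  proof -
    have "p + q = d * (r + \<delta>) / (r * m)" using r m by (simp add: p_def q_def field_simps)
    then show ?thesis using m by (simp add: S_def m_def)
  qed
  have "p / S = r / m" "q / S = \<delta> / m" using r m d by (auto simp: p_def q_def S_def)
  define V where "V = unit_ball_volume N"
  have V: "0 < V" using unit_ball_volume_pos[OF norm] by (simp add: V_def)
  define J where "J = V * S * Beta q (p + 1)"
  define I where "I = (\<integral>x. max 1 (N x) powr (- d * (1 + \<delta> / r)) \<partial>lborel)"
  have "- d * (1 + \<delta> / r) = - m * S" using r by (simp add: S_def m_def field_simps)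
  then have I: "I = V * S / q"
    using integral_max_1_is_norm[OF norm m(1) q] Spq by (simp add: I_def V_def p_def d_def)
  have J: "(\<integral>\<^sup>+x. ennreal ((1 + N x powr (r + \<delta>)) powr (- (d / r))) \<partial>lborel) = ennreal J"
    using nn_integral_one_plus_is_norm[OF norm m(1) q]
    unfolding J_def V_def S_def[symmetric] Spq[symmetric] by (simp only: p_def d_def m_def)
  have Beta: "0 < Beta q (p + 1)" using p q by (simp add: Beta_def)
  have J0: "0 < J" using V S Beta by (simp add: J_def)
  define E where "E k = (\<integral>\<xi>. min_dist N (a ` {1..k}) \<xi> powr r \<partial>P)" for k
  have E0: "0 \<le> E k" for k by (simp add: E_def)
  define \<sigma> where "\<sigma> = (\<integral>\<xi>. N (\<xi> - a 1) powr m \<partial>P) powr (1 / m)"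
  have \<sigma>m: "\<sigma> powr m = (\<integral>\<xi>. N (\<xi> - a 1) powr m \<partial>P)" using m by (simp add: \<sigma>_def powr_powr)
  let ?B = "(1 - b powr r) * b ^ CARD('n)"
  have br: "b powr r < 1" using powr_less_mono2[of r b 1] r b by simp
  have B: "0 < ?B" using br b by simp
  have "E n powr S \<le> ((1 + b) * \<sigma>) powr d * ((S + 1) / q) / (?B * (real n - 1))"
  proof (cases "\<sigma> = 0")
    \<comment> \<open>Here \<open>P\<close> is concentrated at \<open>a 1\<close>, so the error is
      0; the scale chosen in the other case would degenerate.\<close>
    case True
    have intm: "integrable P (\<lambda>\<xi>. N (\<xi> - a 1) powr m)"
      using integrable_is_norm_diff_powr[OF norm P.finite_measure_axioms P(2) m(1) order_refl] moment
      by (simp add: m_def)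
    have "(\<integral>\<xi>. N (\<xi> - a 1) powr m \<partial>P) = 0" using \<sigma>m True by simp
    then have "AE \<xi> in P. N (\<xi> - a 1) powr m = 0"
      using integral_nonneg_eq_0_iff_AE[OF intm] by simp
    then have "AE \<xi> in P. min_dist N (a ` {1..n}) \<xi> powr r = 0"
    proof eventually_elim
      case (elim \<xi>)
      then have "min_dist N (a ` {1..n}) \<xi> \<le> 0" 
        using min_dist_le[of "a ` {1..n}" "a 1" N \<xi>] n by auto
      then show ?case using min_dist_nonneg[OF norm, of "a ` {1..n}" \<xi>] n by simp
    qed
    then have "E n = 0" unfolding E_def by (rule integral_eq_zero_AE)
    then show ?thesis using True by simp
  next
    case False
    then have \<sigma>: "0 < \<sigma>" by (simp add: \<sigma>_def less_le)
    \<comment> \<open>The minimiser of \<open>\<tau> powr d * G powr S\<close>: setting the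
      derivative to zero gives \<open>((1 + b) * \<sigma> / \<tau>) powr m = r / \<delta>\<close>,
      hence \<open>G = m / \<delta>\<close>.\<close>
    define \<tau> where "\<tau> = (1 + b) * \<sigma> * (\<delta> / r) powr (1 / m)"
    have \<tau>: "0 < \<tau>" using b \<sigma> r \<delta> by (simp add: \<tau>_def)
    define G where "G = 1 + ((1 + b) / \<tau>) powr m * (\<integral>\<xi>. N (\<xi> - a 1) powr m \<partial>P)"
    have "((1 + b) / \<tau>) powr m * \<sigma> powr m = ((1 + b) / \<tau> * \<sigma>) powr m" by (rule powr_mult[symmetric])
    also have "(1 + b) / \<tau> * \<sigma> = (\<delta> / r) powr (- (1 / m))"
    proof -
      have "1 + b \<noteq> 0" using b by simp
      then show ?thesis using \<sigma> by (simp add: \<tau>_def powr_minus_divide)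
    qed
    also have "\<dots> powr m = r / \<delta>" using m r \<delta> by (simp only: powr_powr) (simp add: powr_minus_divide)
    finally have "G = 1 + r / \<delta>" by (simp only: G_def \<sigma>m)
    then have G: "G = m / \<delta>" using \<delta> by (simp add: m_def field_simps)
    \<comment> \<open>The constant for which \<open>greedy_recursion\<close> takes the form required
      by \<open>recursive_decrease_bound\<close>.\<close>
    define C where "C = ?B * V / (\<tau> ^ CARD('n) * J * G powr S)"
    have den: "0 < \<tau> ^ CARD('n) * J * G powr S" using \<tau> J0 G m \<delta> by simp
    have C: "0 < C" using B V den by (simp add: C_def)
    have "E (Suc k) + C * E k powr (1 + S) \<le> E k" if "1 \<le> k" for k
    proof -
      have "?B * V * E k powr (1 + S) \<le> (E k - E (Suc k)) * (\<tau> ^ CARD('n) * J) * G powr S"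
        using greedy_recursion[OF \<tau> that, of J] J J0
        by (simp add: E_def V_def S_def G_def m_def d_def)
      then have "?B * V * E k powr (1 + S) \<le> (E k - E (Suc k)) * (\<tau> ^ CARD('n) * J * G powr S)"
        by (simp only: mult.assoc)
      then have "?B * V * E k powr (1 + S) / (\<tau> ^ CARD('n) * J * G powr S) \<le> E k - E (Suc k)"
        by (simp only: pos_divide_le_eq[OF den])
      then have "C * E k powr (1 + S) \<le> E k - E (Suc k)"
        by (simp add: C_def)
      then show ?thesis by simp
    qed
    then have rec: "S * C * (real n - 1) * E n powr S \<le> 1"
      using n by (intro recursive_decrease_bound[OF C S E0]) auto
    have SC: "S * C = ?B / (\<tau> ^ CARD('n) * Beta q (p + 1) * G powr S)"
      using S V by (simp add: C_def J_def)
    \<comment> \<open>With \<open>G powr S = (m / \<delta>) powr p * (m / \<delta>) powr q\<close>,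
      the powers with exponent \<open>p\<close> from \<open>\<tau>\<close>, the Beta bound and
      \<open>G\<close> multiply to 1, and so do those with exponent \<open>q\<close>.\<close>
    have le: "\<tau> ^ CARD('n) * Beta q (p + 1) * G powr S \<le> ((1 + b) * \<sigma>) powr d * ((S + 1) / q)"
    proof -
      have \<tau>_eq: "\<tau> ^ CARD('n) = ((1 + b) * \<sigma>) powr d * (\<delta> / r) powr p"
        using \<tau> by (simp add: powr_realpow[symmetric] d_def[symmetric])
           (simp add: \<tau>_def powr_mult powr_powr p_def)
      have "Beta q (p + 1) \<le> (S + 1) / q * ((\<delta> / m) powr q * (r / m) powr p)"
        using Beta_plus1_le[OF p q] Spq \<open>p / S = r / m\<close> \<open>q / S = \<delta> / m\<close> by simp
      then have "\<tau> ^ CARD('n) * Beta q (p + 1) * G powr S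
          \<le> ((1 + b) * \<sigma>) powr d * (\<delta> / r) powr p * ((S + 1) / q * ((\<delta> / m) powr q * (r / m) powr p)) * G powr S"
        unfolding \<tau>_eq by (intro mult_right_mono mult_left_mono) auto
      also have "\<dots> = ((1 + b) * \<sigma>) powr d * ((S + 1) / q)
          * (((\<delta> / r) powr p * (r / m) powr p * (m / \<delta>) powr p) * ((\<delta> / m) powr q * (m / \<delta>) powr q))"
        by (simp only: G Spq[symmetric] powr_add mult_ac)
      also have "(\<delta> / r) powr p * (r / m) powr p * (m / \<delta>) powr p = 1"
        using r m \<delta> by (simp add: powr_mult[symmetric])
      also have "(\<delta> / m) powr q * (m / \<delta>) powr q = 1"
        using m \<delta> by (simp add: powr_mult[symmetric])
      finally show ?thesis by simp
    qed
    have pos: "0 < \<tau> ^ CARD('n) * Beta q (p + 1) * G powr S" using \<tau> Beta G m \<delta> by simp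
    have "?B / (((1 + b) * \<sigma>) powr d * ((S + 1) / q)) \<le> S * C"
      unfolding SC by (rule divide_left_mono[OF le less_imp_le[OF B] mult_pos_pos[OF less_le_trans[OF pos le] pos]])
    then have "?B / (((1 + b) * \<sigma>) powr d * ((S + 1) / q)) * ((real n - 1) * E n powr S) \<le> S * C * ((real n - 1) * E n powr S)"
      using n by (intro mult_right_mono) auto
    also have "\<dots> \<le> 1" using rec by (simp add: mult.assoc)
    finally have "?B * (real n - 1) * E n powr S \<le> ((1 + b) * \<sigma>) powr d * ((S + 1) / q)"
      using b \<sigma> S q by (simp add: pos_divide_le_eq pos_le_divide_eq mult_ac)
    then show ?thesis using B n by (subst pos_le_divide_eq) (auto simp: mult_ac)
  qed
  \<comment> \<open>Here \<open>(S + 1) / q = S / q * (1 + r / d)\<close> and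
    \<open>S / q = I / V\<close>, so \<open>one_plus_mult_powr_le_2\<close> applies with
    \<open>r / d\<close>.\<close>
  also have "(S + 1) / q \<le> I / V * (2 * (r / d) powr (r / (d + r)))"
  proof -
    have "1 + r / d \<le> 2 * (r / d) powr (r / d / (1 + r / d))"
      using r d by (intro one_plus_mult_powr_le_2) simp
    also have "r / d / (1 + r / d) = r / (d + r)" using r d by (simp add: field_simps)
    finally have "S / q * (1 + r / d) \<le> S / q * (2 * (r / d) powr (r / (d + r)))"
      using S q by (intro mult_left_mono) auto
    moreover have "S / q * (1 + r / d) = (S + 1) / q" using r d q by (simp add: S_def field_simps)
    moreover have "S / q = I / V" using V by (simp add: I)
    ultimately show ?thesis by simp
  qed
  finally have main: "E n powr S \<le> ((1 + b) * \<sigma>) powr d * (I / V * (2 * (r / d) powr (r / (d + r)))) / (?B * (real n - 1))"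
    using B n by (auto simp: divide_right_mono mult_left_mono)
  have "E n powr (1 / r) = (E n powr S) powr (1 / d)" using d by (simp add: powr_powr S_def)
  also have "\<dots> \<le> (((1 + b) * \<sigma>) powr d * (I / V * (2 * (r / d) powr (r / (d + r)))) / (?B * (real n - 1))) powr (1 / d)"
    using main d by (intro powr_mono2) auto
  also have "\<dots> = 2 powr (1 / d) * V powr (- 1 / d) * (r / d) powr (r / (d * (d + r)))
      * ((1 + b) * ?B powr (- 1 / d)) * I powr (1 / d) * \<sigma> * (real n - 1) powr (- 1 / d)"
  proof -
    have "(((1 + b) * \<sigma>) powr d) powr (1 / d) = (1 + b) * \<sigma>"
      using d b by (simp add: powr_powr \<sigma>_def)
    moreover have "((r / d) powr (r / (d + r))) powr (1 / d) = (r / d) powr (r / (d * (d + r)))"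
      by (simp add: powr_powr mult.commute)
    ultimately show ?thesis
      by (simp only: powr_mult powr_divide minus_divide_left[symmetric] powr_minus_divide) (simp add: mult_ac)
  qed
  finally show ?thesis by (simp add: E_def V_def I_def \<sigma>_def)
qed

end

subsection \<open>Dilation\<close>

text \<open>The substitution by \<open>dilate \<theta> \<mu>\<close> gives the factor
  \<open>\<theta> powr (d + s)\<close> and the integrand \<open>f (?T x) * ?D x powr s\<close>. It
  factors as \<open>u powr \<alpha> * v powr (1 - \<alpha>)\<close> with
  \<open>\<alpha> = s / r\<close>, where \<open>u\<close> carries the L^r error and \<open>v\<close>
  the dilation integrand. On the set \<open>f x = 0\<close> both sides of this factorisation vanish,
  the left one almost everywhere by \<open>abs_cont\<close>.\<close>

lemma quant_error_dilate_le:
  fixes N :: "real^'n \<Rightarrow> real" and f :: "real^'n \<Rightarrow> real" and \<mu> :: "real^'n" and r s \<theta> :: real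
  defines "P \<equiv> density lborel (\<lambda>x. ennreal (f x))"
  assumes norm: "is_norm N" and s: "0 < s" "s < r" and \<theta>: "0 < \<theta>"
    and f: "f \<in> borel_measurable borel" "\<And>x. 0 \<le> f x"
    and A: "finite A" "A \<noteq> {}"
    and int: "integrable P (\<lambda>\<xi>. min_dist N A \<xi> powr r)"
    and abs_cont: "AE x in lborel. f x = 0 \<longrightarrow> f (dilate \<theta> \<mu> x) = 0"
    and finite: "set_integrable lborel {x. f x > 0} (dilation_integrand r s \<theta> \<mu> f)"
  shows "quant_error N s (dilate \<theta> \<mu> ` A) P
    \<le> \<theta> powr (1 + real CARD('n) / s)
      * (LINT x:{x. f x > 0}|lborel. dilation_integrand r s \<theta> \<mu> f x) powr ((r - s) / (s * r))
      * (\<integral>\<xi>. min_dist N A \<xi> powr r \<partial>P) powr (1 / r)"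
proof -
  define d where "d = real CARD('n)"
  let ?D = "min_dist N A" and ?T = "dilate \<theta> \<mu>"
  let ?D' = "min_dist N (?T ` A)"
  define E where "E = (\<integral>\<xi>. ?D \<xi> powr r \<partial>P)"
  define L where "L = (LINT x:{x. f x > 0}|lborel. dilation_integrand r s \<theta> \<mu> f x)"
  have r: "0 < r" using s by simp
  have [measurable]: "f \<in> borel_measurable borel" by (rule f)
  have [measurable]: "?D \<in> borel_measurable borel" "?D' \<in> borel_measurable borel"
    using A by (auto intro: min_dist_measurable[OF norm])
  have [measurable]: "?T \<in> borel_measurable borel" unfolding dilate_def[abs_def] by measurable
  define \<alpha> where "\<alpha> = s / r"
  have \<alpha>: "0 < \<alpha>" "\<alpha> < 1" using s by (auto simp: \<alpha>_def)
  define u where "u x = f x * ?D x powr r" for x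
  define v where "v x = indicator {x. f x > 0} x * dilation_integrand r s \<theta> \<mu> f x" for x
  have intu: "integrable lborel u"
    using int f unfolding P_def by (subst (asm) integrable_density) (auto simp: u_def[abs_def])
  have E: "(\<integral>x. u x \<partial>lborel) = E"
    unfolding E_def P_def using f by (subst integral_density) (auto simp: u_def[abs_def])
  have intv: "integrable lborel v" using finite by (simp add: v_def[abs_def] set_integrable_def)
  have L: "(\<integral>x. v x \<partial>lborel) = L" by (simp add: L_def v_def set_lebesgue_integral_def)
  have u0: "0 \<le> u x" and v0: "0 \<le> v x" for x
    using f by (auto simp: u_def v_def dilation_integrand_def)
  have uv: "f (?T x) * ?D x powr s = u x powr \<alpha> * v x powr (1 - \<alpha>)"
    if "f x = 0 \<longrightarrow> f (?T x) = 0" for x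
  proof (cases "f x = 0")
    case False
    then have pos: "0 < f x" using f(2)[of x] by simp
    \<comment> \<open>With these exponents \<open>v x powr (1 - \<alpha>)\<close> contributes
      \<open>f x powr (- \<alpha>)\<close>, which cancels the power of \<open>f x\<close> in
      \<open>u x powr \<alpha>\<close> and leaves \<open>f (?T x)\<close>.\<close>
    have e: "- s / (r - s) * (1 - \<alpha>) = - \<alpha>" "r / (r - s) * (1 - \<alpha>) = 1" "r * \<alpha> = s"
      using s by (auto simp: \<alpha>_def field_simps)
    have "u x powr \<alpha> = f x powr \<alpha> * ?D x powr s"
      by (simp only: u_def powr_mult powr_powr e)
    moreover have "v x = f x powr (- s / (r - s)) * f (?T x) powr (r / (r - s))"
      using pos by (simp add: v_def dilation_integrand_def)
    then have "v x powr (1 - \<alpha>) = f x powr (- \<alpha>) * f (?T x) powr 1"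
      by (simp only: powr_mult powr_powr e)
    then have "v x powr (1 - \<alpha>) = f x powr (- \<alpha>) * f (?T x)"
      using f(2) by simp
    moreover have "f x powr \<alpha> * f x powr (- \<alpha>) = 1" using pos by (simp add: powr_add[symmetric])
    ultimately show ?thesis by (simp add: mult_ac)
  qed (use that in \<open>simp add: u_def\<close>)
  have "(\<integral>\<xi>. ?D' \<xi> powr s \<partial>P) = (\<integral>\<xi>. f \<xi> * ?D' \<xi> powr s \<partial>lborel)"
    unfolding P_def using f by (subst integral_density) auto
  also have "\<dots> = \<bar>\<theta>\<bar> ^ DIM(real^'n) * (\<integral>x. f ((\<mu> - \<theta> *\<^sub>R \<mu>) + \<theta> *\<^sub>R x) * ?D' ((\<mu> - \<theta> *\<^sub>R \<mu>) + \<theta> *\<^sub>R x) powr s \<partial>lborel)"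
    by (rule integral_lborel_affine) (use \<theta> in simp, measurable)
  also have "\<dots> = \<theta> powr d * (\<integral>x. f (?T x) * ?D' (?T x) powr s \<partial>lborel)"
  proof -
    have "(\<mu> - \<theta> *\<^sub>R \<mu>) + \<theta> *\<^sub>R x = ?T x" for x by (simp add: dilate_def algebra_simps)
    then show ?thesis using \<theta> by (simp add: d_def powr_realpow)
  qed
  also have "(\<lambda>x. f (?T x) * ?D' (?T x) powr s) = (\<lambda>x. \<theta> powr s * (f (?T x) * ?D x powr s))"
    by (simp add: min_dist_dilate[OF norm A \<theta>] powr_mult mult_ac)
  also have "\<theta> powr d * (\<integral>x. \<theta> powr s * (f (?T x) * ?D x powr s) \<partial>lborel)
      = \<theta> powr (d + s) * (\<integral>x. f (?T x) * ?D x powr s \<partial>lborel)"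
    by (simp add: powr_add)
  also have "(\<integral>x. f (?T x) * ?D x powr s \<partial>lborel) = (\<integral>x. u x powr \<alpha> * v x powr (1 - \<alpha>) \<partial>lborel)"
  proof (rule integral_cong_AE)
    show "AE x in lborel. f (?T x) * ?D x powr s = u x powr \<alpha> * v x powr (1 - \<alpha>)"
      using abs_cont by eventually_elim (rule uv)
  qed (use intu intv in measurable)
  finally have "(\<integral>\<xi>. ?D' \<xi> powr s \<partial>P) \<le> \<theta> powr (d + s) * (E powr \<alpha> * L powr (1 - \<alpha>))"
    using Holder_powr(2)[OF \<alpha> intu intv u0 v0] by (simp add: E L mult_left_mono)
  then have "(\<integral>\<xi>. ?D' \<xi> powr s \<partial>P) powr (1 / s)
      \<le> (\<theta> powr (d + s) * (E powr \<alpha> * L powr (1 - \<alpha>))) powr (1 / s)"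
    using s by (intro powr_mono2) auto
  also have "\<dots> = \<theta> powr (1 + d / s) * L powr ((r - s) / (s * r)) * E powr (1 / r)"
  proof -
    have "(d + s) * (1 / s) = 1 + d / s" "\<alpha> * (1 / s) = 1 / r" "(1 - \<alpha>) * (1 / s) = (r - s) / (s * r)"
      using s by (auto simp: \<alpha>_def field_simps)
    then show ?thesis by (simp only: powr_mult powr_powr mult_ac)
  qed
  finally show ?thesis
    using A s quant_error_eq[OF norm, of "?T ` A" s P] by (simp add: E_def L_def d_def)
qed

theorem theorem3p2:
  fixes N :: "real^'n \<Rightarrow> real"
    and M :: "'w measure"
    and X :: "'w \<Rightarrow> real^'n"
    and f :: "real^'n \<Rightarrow> real"
    and a :: "nat \<Rightarrow> real^'n"
    and r s \<theta> \<delta> :: real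
    and \<mu> :: "real^'n"
    and n :: nat
  defines "P \<equiv> distr M lborel X"
  assumes norm: "is_norm N"
    and r: "0 < r" and s: "0 < s" "s < r" and \<theta>: "0 < \<theta>" and \<delta>: "0 < \<delta>"
    and prob: "prob_space M"
    and f_nonneg: "\<And>x. 0 \<le> f x"
    and density: "distributed M lborel X (\<lambda>x. ennreal (f x))"
    and moment: "integrable M (\<lambda>\<omega>. N (X \<omega>) powr (r + \<delta>))"
    and greedy: "greedy_quantization N r P a"
    and abs_cont: "AE x in lborel. f x = 0 \<longrightarrow> f (dilate \<theta> \<mu> x) = 0"
    and integral_finite: "set_integrable lborel {x. f x > 0} (dilation_integrand r s \<theta> \<mu> f)"
    and n: "3 \<le> n"
  shows "integrable M (\<lambda>\<omega>. N (X \<omega> - a 1) powr (r + \<delta>))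
    \<and> quant_error N (r + \<delta>) (a ` {1..1}) P
        = (\<integral>\<omega>. N (X \<omega> - a 1) powr (r + \<delta>) \<partial>M) powr (1 / (r + \<delta>))
    \<and> quant_error N s (dilate \<theta> \<mu> ` a ` {1..n}) P
        \<le> kappa N r \<delta> * \<theta> powr (1 + real CARD('n) / s)
          * (LINT x:{x. f x > 0}|lborel. dilation_integrand r s \<theta> \<mu> f x) powr ((r - s) / (s * r))
          * quant_error N (r + \<delta>) (a ` {1..1}) P
          * (real n - 2) powr (- 1 / real CARD('n))"
proof -
  interpret M: prob_space M by (rule prob)
  have [measurable]: "N \<in> borel_measurable borel" by (rule is_norm_borel_measurable[OF norm])
  have X [measurable]: "X \<in> borel_measurable M"
    using distributed_measurable[OF density] by simp
  have P: "prob_space P" "sets P = sets borel"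
    unfolding P_def by (auto intro!: M.prob_space_distr)
  have P_density: "P = density lborel (\<lambda>x. ennreal (f x))"
    unfolding P_def using density by (rule distributed_distr_eq_density)
  \<comment> \<open>Only \<open>ennreal (f x)\<close> is known to be measurable; for nonnegative
    \<open>f\<close>, \<open>enn2real\<close> recovers the function itself.\<close>
  have f: "f \<in> borel_measurable borel"
  proof -
    have "(\<lambda>x. enn2real (ennreal (f x))) \<in> borel_measurable borel"
      using distributed_borel_measurable[OF density] by measurable
    then show ?thesis using f_nonneg by simp
  qed
  have moment_P: "integrable P (\<lambda>\<xi>. N \<xi> powr (r + \<delta>))"
    unfolding P_def using moment by (subst integrable_distr_eq) auto
  have fin: "finite_measure P" using P(1) by (rule prob_space.finite_measure)
  have int_a: "integrable P (\<lambda>\<xi>. N (\<xi> - a 1) powr t)" if "0 < t" "t \<le> r + \<delta>" for t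
    using integrable_is_norm_diff_powr[OF norm fin P(2) that moment_P] .
  have int_m: "integrable P (\<lambda>\<xi>. N (\<xi> - a 1) powr (r + \<delta>))" using int_a r \<delta> by simp
  have A: "finite (a ` {1..n})" "a ` {1..n} \<noteq> {}" "a 1 \<in> a ` {1..n}" using n by auto
  have int_D: "integrable P (\<lambda>\<xi>. min_dist N (a ` {1..n}) \<xi> powr r)"
    using int_a[of r] r \<delta> by (intro integrable_min_dist_powr[OF norm P(2) A(1,3)]) auto
  define d where "d = real CARD('n)"
  have d: "0 < d" by (simp add: d_def)
  define \<sigma> where "\<sigma> = (\<integral>\<xi>. N (\<xi> - a 1) powr (r + \<delta>) \<partial>P) powr (1 / (r + \<delta>))"
  have \<sigma>: "quant_error N (r + \<delta>) (a ` {1..1}) P = \<sigma>"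
    by (simp add: quant_error_def \<sigma>_def)
  have int_M: "integrable M (\<lambda>\<omega>. N (X \<omega> - a 1) powr (r + \<delta>))"
    using int_m unfolding P_def by (subst (asm) integrable_distr_eq) auto
  have \<sigma>_M: "\<sigma> = (\<integral>\<omega>. N (X \<omega> - a 1) powr (r + \<delta>) \<partial>M) powr (1 / (r + \<delta>))"
    unfolding \<sigma>_def P_def by (subst integral_distr) auto
  \<comment> \<open>The ratio \<open>b\<close> is taken as a minimiser of the expression defining
    \<open>min_factor\<close>.\<close>
  obtain b where b: "0 < b" "b < 1/3" and
    b_min: "(1 + b) * phi CARD('n) r b powr (- 1 / d) = min_factor CARD('n) r"
    using min_factor_attained[of "CARD('n)" r] r by (auto simp: d_def Suc_le_eq)
  define E where "E = (\<integral>\<xi>. min_dist N (a ` {1..n}) \<xi> powr r \<partial>P) powr (1 / r)"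
  define V where "V = unit_ball_volume N powr (- 1 / d)"
  define R where "R = (r / d) powr (r / (d * (d + r)))"
  define I where "I = (\<integral>x. max 1 (N x) powr (- d * (1 + \<delta> / r)) \<partial>lborel) powr (1 / d)"
  have nonneg: "0 \<le> V" "0 \<le> R" "0 \<le> I" "0 \<le> \<sigma>" by (simp_all add: V_def R_def I_def \<sigma>_def)
  have "E \<le> 2 powr (1 / d) * V * R * ((1 + b) * ((1 - b powr r) * b ^ CARD('n)) powr (- 1 / d))
      * I * \<sigma> * (real n - 1) powr (- 1 / d)"
    unfolding E_def V_def R_def I_def \<sigma>_def d_def
    using greedy_Pierce[OF norm P r \<delta> _ _ moment_P greedy, of b n] b n by simp
  \<comment> \<open>The bound just obtained is weakened in three places: a larger power of 2,
    \<open>(1/3) powr r\<close> in place of 1 inside \<open>phi\<close>, and \<open>n - 2\<close> in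
    place of \<open>n - 1\<close>. The last two lower a quantity raised to the negative power
    \<open>- 1 / d\<close>.\<close>
  also have "\<dots> \<le> 2 powr (1 + 1 / d + \<delta> / r) * V * R * min_factor CARD('n) r * I * \<sigma> * (real n - 2) powr (- 1 / d)"
  proof (intro mult_mono)
    show "2 powr (1 / d) \<le> 2 powr (1 + 1 / d + \<delta> / r)" using r \<delta> by (intro powr_mono) auto
    show "(real n - 1) powr (- 1 / d) \<le> (real n - 2) powr (- 1 / d)"
      using n d by (intro powr_mono2') auto
    have "(1 / 3) powr r \<le> (1::real)" using powr_mono2[of r "1 / 3" "1 :: real"] r by simp
    then have "phi CARD('n) r b \<le> (1 - b powr r) * b ^ CARD('n)"
      unfolding phi_def using b by (intro mult_right_mono) auto
    then have "((1 - b powr r) * b ^ CARD('n)) powr (- 1 / d) \<le> phi CARD('n) r b powr (- 1 / d)"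
      using phi_pos[OF r b] d by (intro powr_mono2') auto
    then show "(1 + b) * ((1 - b powr r) * b ^ CARD('n)) powr (- 1 / d) \<le> min_factor CARD('n) r"
      unfolding b_min[symmetric] using b by (intro mult_left_mono) auto
  qed (use nonneg b b_min[symmetric] in auto)
  also have "\<dots> = kappa N r \<delta> * \<sigma> * (real n - 2) powr (- 1 / d)"
    by (simp add: kappa_def Let_def V_def R_def I_def d_def)
  finally have Pierce: "E \<le> kappa N r \<delta> * \<sigma> * (real n - 2) powr (- 1 / d)" .
  have "quant_error N s (dilate \<theta> \<mu> ` a ` {1..n}) P \<le> \<theta> powr (1 + real CARD('n) / s)
      * (LINT x:{x. f x > 0}|lborel. dilation_integrand r s \<theta> \<mu> f x) powr ((r - s) / (s * r)) * E"
    unfolding E_def P_density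
    by (rule quant_error_dilate_le[OF norm s \<theta> f f_nonneg A(1,2) int_D[unfolded P_density] abs_cont integral_finite])
  also have "\<dots> \<le> \<theta> powr (1 + real CARD('n) / s)
      * (LINT x:{x. f x > 0}|lborel. dilation_integrand r s \<theta> \<mu> f x) powr ((r - s) / (s * r))
      * (kappa N r \<delta> * \<sigma> * (real n - 2) powr (- 1 / d))"
    by (intro mult_left_mono Pierce) auto
  finally have "quant_error N s (dilate \<theta> \<mu> ` a ` {1..n}) P
        \<le> kappa N r \<delta> * \<theta> powr (1 + real CARD('n) / s)
          * (LINT x:{x. f x > 0}|lborel. dilation_integrand r s \<theta> \<mu> f x) powr ((r - s) / (s * r))
          * \<sigma> * (real n - 2) powr (- 1 / real CARD('n))"
    by (simp only: mult_ac d_def)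
  then show ?thesis using int_M \<sigma> \<sigma>_M by simp
qed

end
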